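(* For CMIP (covering mixed integer linear programs with upper bounds), the greedy algorithm can be implemented to return a $\Delta$-approximate solution in $O(N\log\Delta)$ time, where $\Delta$ is the maximum number of non-zeroes in any constraint (row of $A$) and $N$ is the total number of non-zeroes in the constraint matrix $A$.
   Context: A CMIP instance is $\min\{c\cdot x: x\in\mathbb R_+^n,\ Ax\ge b,\ x\le u,\ x_j\in\mathbb Z\ (j\in I)\}$ with non-negative data $A,b,c,u$ and a set $I$ of integer variables. It is modeled as a monotone covering instance with cost $c\cdot x$ over $x\in\mathbb R_+^n$, where each row $i$ becomes the monotone constraint $\sum_{j\in I}A_{ij}\lfloor\min(x_j,u_j)\rfloor+\sum_{j\notin I}A_{ij}\min(x_j,u_j)\ge b_i$. For a constraint $S$, $\mathrm{vars}(S)$ is the set of variables it depends on. The greedy algorithm for monotone covering: start with $x=\mathbf 0$; while some constraint $S$ is violated, perform $\mathrm{step}(x,S)$: choose a step size $\beta$ with $0\le\beta\le\inf\{c\cdot\hat x-c\cdot x:\hat x\in S,\hat x\ge x\}$, and raise each $x_j$, $j\in\mathrm{vars}(S)$, by $\beta/c_j$. A $\Delta$-approximate solution is a feasible solution of the CMIP (obtained from the final $x$ by taking $\min(x_j,u_j)$, floored for $j\in I$) of cost at most $\Delta$ times the CMIP optimum. *)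

theory Defs
  imports Complex_Main "HOL-Library.Extended_Real"
begin

section \<open>Covering mixed integer linear programs\<close>

text \<open>Variables are indexed by \<open>{..<nvars P}\<close> and rows by \<open>{..<nrows P}\<close>; points are functions
  of which only the values on \<open>{..<nvars P}\<close> matter.\<close>

record cmip =
  nvars :: nat
  nrows :: nat
  mat :: "nat \<Rightarrow> nat \<Rightarrow> real"
  rhs :: "nat \<Rightarrow> real"
  price :: "nat \<Rightarrow> real"
  ub :: "nat \<Rightarrow> real"
  ints :: "nat set"

definition wf_cmip :: "cmip \<Rightarrow> bool" where
  "wf_cmip P \<longleftrightarrow>
     (\<forall>i<nrows P. \<forall>j<nvars P. 0 \<le> mat P i j) \<and>
     (\<forall>i<nrows P. 0 \<le> rhs P i) \<and>
     (\<forall>j<nvars P. 0 \<le> price P j \<and> 0 \<le> ub P j) \<and>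
     ints P \<subseteq> {..<nvars P}"

definition cost :: "cmip \<Rightarrow> (nat \<Rightarrow> real) \<Rightarrow> real" where
  "cost P x = (\<Sum>j<nvars P. price P j * x j)"

definition cmip_feasible :: "cmip \<Rightarrow> (nat \<Rightarrow> real) set" where
  "cmip_feasible P =
     {x. (\<forall>j<nvars P. 0 \<le> x j \<and> x j \<le> ub P j) \<and>
         (\<forall>i<nrows P. (\<Sum>j<nvars P. mat P i j * x j) \<ge> rhs P i) \<and>
         (\<forall>j\<in>ints P. x j \<in> \<int>)}"

definition cmip_opt :: "cmip \<Rightarrow> real" where
  "cmip_opt P = (INF x\<in>cmip_feasible P. cost P x)"

definition approx_solution :: "cmip \<Rightarrow> real \<Rightarrow> (nat \<Rightarrow> real) \<Rightarrow> bool" where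
  "approx_solution P \<alpha> x \<longleftrightarrow> x \<in> cmip_feasible P \<and> cost P x \<le> \<alpha> * cmip_opt P"

definition vars :: "cmip \<Rightarrow> nat \<Rightarrow> nat set" where
  "vars P i = {j. j < nvars P \<and> mat P i j \<noteq> 0}"

definition max_row_nnz :: "cmip \<Rightarrow> nat" where
  "max_row_nnz P = Max (insert 0 ((\<lambda>i. card (vars P i)) ` {..<nrows P}))"

definition nnz :: "cmip \<Rightarrow> nat" where
  "nnz P = (\<Sum>i<nrows P. card (vars P i))"


section \<open>The greedy algorithm for the monotone covering instance\<close>

definition cap_floor :: "cmip \<Rightarrow> (nat \<Rightarrow> real) \<Rightarrow> nat \<Rightarrow> real" where
  "cap_floor P x j =
     (if j \<in> ints P then of_int \<lfloor>min (x j) (ub P j)\<rfloor> else min (x j) (ub P j))"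

definition row_constraint :: "cmip \<Rightarrow> nat \<Rightarrow> (nat \<Rightarrow> real) set" where
  "row_constraint P i =
     {x. (\<forall>j<nvars P. 0 \<le> x j) \<and>
         (\<Sum>j\<in>ints P. mat P i j * of_int \<lfloor>min (x j) (ub P j)\<rfloor>) +
         (\<Sum>j\<in>{..<nvars P} - ints P. mat P i j * min (x j) (ub P j)) \<ge> rhs P i}"

text \<open>If \<open>price P j = 0\<close>, the increment \<open>\<beta> / price P j\<close> is \<open>\<infinity>\<close> (also for \<open>\<beta> = 0\<close>: such a
  variable is raised as far as the extra cost \<open>\<beta>\<close> allows). As all constraints depend on \<open>x j\<close> only
  through \<open>min (x j) (ub P j)\<close>, the real value \<open>max (x j) (ub P j)\<close> stands for \<open>\<infinity>\<close>.\<close>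

definition greedy_step :: "cmip \<Rightarrow> nat \<Rightarrow> real \<Rightarrow> (nat \<Rightarrow> real) \<Rightarrow> nat \<Rightarrow> real" where
  "greedy_step P i \<beta> x j =
     (if j \<in> vars P i
      then if price P j = 0 then max (x j) (ub P j) else x j + \<beta> / price P j
      else x j)"

text \<open>The infimum is taken in \<^typ>\<open>ereal\<close>, so that it is \<open>\<infinity>\<close> over the empty set.\<close>

inductive greedy_reaches :: "cmip \<Rightarrow> (nat \<Rightarrow> real) \<Rightarrow> bool" for P where
  start: "greedy_reaches P (\<lambda>_. 0)"
| step: "greedy_reaches P (greedy_step P i \<beta> x)"
    if "greedy_reaches P x" and "i < nrows P" and "x \<notin> row_constraint P i"
      and "0 \<le> \<beta>"
      and "ereal \<beta> \<le> (INF y\<in>{y \<in> row_constraint P i. \<forall>j<nvars P. x j \<le> y j}.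
                          ereal (cost P y - cost P x))"

definition greedy_final :: "cmip \<Rightarrow> (nat \<Rightarrow> real) \<Rightarrow> bool" where
  "greedy_final P x \<longleftrightarrow> greedy_reaches P x \<and> (\<forall>i<nrows P. x \<in> row_constraint P i)"


section \<open>A unit-cost RAM over indices and reals\<close>

text \<open>The memory consists of index arrays and real arrays; scalars are arrays used at position 0.
  Reals cannot be turned into indices, indices can only be added, subtracted (truncating at 0) and
  halved, and the only literal constants of type \<^typ>\<open>real\<close> are integers, so no information can be
  packed into program constants.\<close>

type_synonym vname = string

record state =
  ix :: "vname \<Rightarrow> nat \<Rightarrow> nat"
  re :: "vname \<Rightarrow> nat \<Rightarrow> real"

datatype iexp =
    IConst nat
  | IGet vname iexp
  | IAdd iexp iexp
  | ISub iexp iexp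
  | IHalf iexp

datatype rexp =
    RConst int
  | RGet vname iexp
  | RAdd rexp rexp
  | RSub rexp rexp
  | RMul rexp rexp
  | RDiv rexp rexp
  | RFloor rexp

datatype bexp =
    ILess iexp iexp
  | RLess rexp rexp
  | BNot bexp
  | BAnd bexp bexp

datatype com =
    Skip
  | ISet vname iexp iexp
  | RSet vname iexp rexp
  | Seq com com
  | If bexp com com
  | While bexp com

primrec ival :: "iexp \<Rightarrow> state \<Rightarrow> nat" where
  "ival (IConst k) s = k"
| "ival (IGet a e) s = ix s a (ival e s)"
| "ival (IAdd e f) s = ival e s + ival f s"
| "ival (ISub e f) s = ival e s - ival f s"
| "ival (IHalf e) s = ival e s div 2"

primrec rval :: "rexp \<Rightarrow> state \<Rightarrow> real" where
  "rval (RConst k) s = of_int k"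
| "rval (RGet a e) s = re s a (ival e s)"
| "rval (RAdd e f) s = rval e s + rval f s"
| "rval (RSub e f) s = rval e s - rval f s"
| "rval (RMul e f) s = rval e s * rval f s"
| "rval (RDiv e f) s = rval e s / rval f s"
| "rval (RFloor e) s = of_int \<lfloor>rval e s\<rfloor>"

primrec bval :: "bexp \<Rightarrow> state \<Rightarrow> bool" where
  "bval (ILess e f) s \<longleftrightarrow> ival e s < ival f s"
| "bval (RLess e f) s \<longleftrightarrow> rval e s < rval f s"
| "bval (BNot p) s \<longleftrightarrow> \<not> bval p s"
| "bval (BAnd p q) s \<longleftrightarrow> bval p s \<and> bval q s"

primrec itime :: "iexp \<Rightarrow> nat" where
  "itime (IConst k) = 1"
| "itime (IGet a e) = 1 + itime e"
| "itime (IAdd e f) = 1 + itime e + itime f"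
| "itime (ISub e f) = 1 + itime e + itime f"
| "itime (IHalf e) = 1 + itime e"

primrec rtime :: "rexp \<Rightarrow> nat" where
  "rtime (RConst k) = 1"
| "rtime (RGet a e) = 1 + itime e"
| "rtime (RAdd e f) = 1 + rtime e + rtime f"
| "rtime (RSub e f) = 1 + rtime e + rtime f"
| "rtime (RMul e f) = 1 + rtime e + rtime f"
| "rtime (RDiv e f) = 1 + rtime e + rtime f"
| "rtime (RFloor e) = 1 + rtime e"

primrec btime :: "bexp \<Rightarrow> nat" where
  "btime (ILess e f) = 1 + itime e + itime f"
| "btime (RLess e f) = 1 + rtime e + rtime f"
| "btime (BNot p) = 1 + btime p"
| "btime (BAnd p q) = 1 + btime p + btime q"

definition ix_write :: "vname \<Rightarrow> nat \<Rightarrow> nat \<Rightarrow> state \<Rightarrow> state" where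
  "ix_write a k v s = s\<lparr>ix := (ix s)(a := (ix s a)(k := v))\<rparr>"

definition re_write :: "vname \<Rightarrow> nat \<Rightarrow> real \<Rightarrow> state \<Rightarrow> state" where
  "re_write a k v s = s\<lparr>re := (re s)(a := (re s a)(k := v))\<rparr>"

text \<open>\<open>exec p s t s'\<close>: program \<open>p\<close> started in \<open>s\<close> halts in \<open>s'\<close> after \<open>t\<close> time units.\<close>

inductive exec :: "com \<Rightarrow> state \<Rightarrow> nat \<Rightarrow> state \<Rightarrow> bool" where
  Skip: "exec Skip s 1 s"
| ISet: "exec (ISet a e f) s (1 + itime e + itime f) (ix_write a (ival e s) (ival f s) s)"
| RSet: "exec (RSet a e f) s (1 + itime e + rtime f) (re_write a (ival e s) (rval f s) s)"
| Seq: "exec (Seq p q) s (t + t') s''" if "exec p s t s'" and "exec q s' t' s''"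
| IfTrue: "exec (If g p q) s (1 + btime g + t) s'" if "bval g s" and "exec p s t s'"
| IfFalse: "exec (If g p q) s (1 + btime g + t) s'" if "\<not> bval g s" and "exec q s t s'"
| WhileFalse: "exec (While g p) s (1 + btime g) s" if "\<not> bval g s"
| WhileTrue: "exec (While g p) s (1 + btime g + t + t') s''"
    if "bval g s" and "exec p s t s'" and "exec (While g p) s' t' s''"

inductive_cases SkipE: "exec Skip s t s'"
inductive_cases ISetE: "exec (ISet a e f) s t s'"
inductive_cases RSetE: "exec (RSet a e f) s t s'"
inductive_cases SeqE: "exec (Seq p q) s t s'"
inductive_cases IfE: "exec (If g p q) s t s'"
inductive_cases WhileE: "exec (While g p) s t s'"

lemma exec_deterministic:
  "exec p s t s' \<Longrightarrow> exec p s t1 s1 \<Longrightarrow> t1 = t \<and> s1 = s'"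
proof (induction arbitrary: t1 s1 rule: exec.induct)
  case Skip then show ?case by (auto elim: SkipE)
next
  case ISet then show ?case by (auto elim: ISetE)
next
  case RSet then show ?case by (auto elim: RSetE)
next
  case (Seq p s t s' q t' s'')
  from Seq.prems show ?case by (rule SeqE) (use Seq.IH in \<open>metis plus_1_eq_Suc add_Suc\<close>)
next
  case (IfTrue g s p t s' q)
  from IfTrue.prems show ?case by (rule IfE) (use IfTrue.hyps IfTrue.IH in \<open>metis plus_1_eq_Suc add_Suc\<close>)+
next
  case (IfFalse g s q t s' p)
  from IfFalse.prems show ?case by (rule IfE) (use IfFalse.hyps IfFalse.IH in \<open>metis plus_1_eq_Suc add_Suc\<close>)+
next
  case (WhileFalse g s p)
  from WhileFalse.prems show ?case by (rule WhileE) (use WhileFalse.hyps in \<open>metis plus_1_eq_Suc add_Suc\<close>)+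
next
  case (WhileTrue g s p t s' t' s'')
  from WhileTrue.prems show ?case by (rule WhileE) (use WhileTrue.hyps WhileTrue.IH in \<open>metis plus_1_eq_Suc add_Suc\<close>)+
qed


section \<open>Input format\<close>

text \<open>The matrix is given sparsely, as a list of the positions of its non-zeroes in which the entries
  of each row are consecutive.\<close>

definition sparse_rows :: "cmip \<Rightarrow> (nat \<times> nat) list \<Rightarrow> bool" where
  "sparse_rows P es \<longleftrightarrow>
     distinct es \<and> sorted (map fst es) \<and> set es = {(i, j). i < nrows P \<and> j \<in> vars P i}"

text \<open>All memory cells that do not hold input are initially 0.\<close>

definition input_state :: "cmip \<Rightarrow> (nat \<times> nat) list \<Rightarrow> state" where
  "input_state P es =
    \<lparr>ix = (\<lambda>a k.
        if a = ''nnz'' \<and> k = 0 then length es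
        else if a = ''nvars'' \<and> k = 0 then nvars P
        else if a = ''nrows'' \<and> k = 0 then nrows P
        else if a = ''row'' \<and> k < length es then fst (es ! k)
        else if a = ''col'' \<and> k < length es then snd (es ! k)
        else if a = ''int'' \<and> k \<in> ints P then 1
        else 0),
     re = (\<lambda>a k.
        if a = ''val'' \<and> k < length es then mat P (fst (es ! k)) (snd (es ! k))
        else if a = ''rhs'' \<and> k < nrows P then rhs P k
        else if a = ''price'' \<and> k < nvars P then price P k
        else if a = ''ub'' \<and> k < nvars P then ub P k
        else 0)\<rparr>"

end

theory Submission
  imports Defs
begin

text \<open>
  Each row needs at most one greedy step. If the row is violated at \<open>x\<close>, let \<open>T\<close> be the least step
  size after which it is satisfied. Any \<open>y \<ge> x\<close> that satisfies the row at extra cost \<open>t\<close> lies, up to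
  capping, below the result of the step of size \<open>t\<close>; hence \<open>T \<le> t\<close>, and \<open>T\<close> is a valid step size.

  For a row with \<open>d\<close> entries, \<open>T\<close> is found by simulating \<open>O(d)\<close> events in increasing order of time.
  Initially integrality is relaxed, so that the left-hand side is piecewise linear and its breakpoints
  are the times at which variables reach their upper bounds. Whenever the relaxed row becomes
  satisfied, or an already discrete variable reaches its next integer, the relaxed integer variable
  with the largest coefficient is made discrete: it is rounded down and its next integer becomes an
  event. Rounding loses at most the sum of the coefficients of the relaxed variables, and an integer
  event gains at least the least coefficient of the discrete ones; so when no relaxed variable is left
  to be made discrete, no slack is left either. Tournament trees provide the next event and the
  largest coefficient in time \<open>O(log d)\<close>.

  The approximation ratio is the usual one: a step of size \<open>\<beta>\<close> reduces the cost of raising \<open>x\<close> to a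
  feasible point by at least \<open>\<beta>\<close>, and costs at most \<open>\<beta>\<close> per variable of the row.
\<close>


section \<open>Time-annotated weakest preconditions\<close>

text \<open>The obstacle is integrality. Before the least step size is reached, an integer variable
  may pass arbitrarily many integers, so simulating all its jumps has no bound in terms of
  \<open>d\<close>, while relaxing it throughout gives only a lower bound on the step size. The
  jumps are therefore rationed: every integer event is followed by the removal of one variable from
  \<open>R\<close> or by halting, so only \<open>O(d)\<close> of them are ever executed.

  Two estimates of the left-hand side are kept apart. The line
  \<open>offset md n + rate md * t\<close>, which the program evaluates, bounds
  \<open>total t\<close> from above before the next event; it shows that no smaller step size
  suffices. The sum of the \<open>credit\<close> values, rounded down, bounds \<open>total T\<close>
  from below; it occurs in proofs only and certifies that the final \<open>T\<close> suffices.
  \<open>slack\<close> is measured against the second estimate, and the difference between the two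
  is what rounding can lose on \<open>R\<close>.\<close>

definition wp :: "com \<Rightarrow> (state \<Rightarrow> nat \<Rightarrow> bool) \<Rightarrow> state \<Rightarrow> nat \<Rightarrow> bool" where
  "wp c Q s t \<longleftrightarrow> (\<exists>u s'. exec c s u s' \<and> Q s' (t + u))"

text \<open>Without this rule the simplifier would expand postconditions before the state they are applied
  to is known, which takes exponential time in the length of the program.\<close>

lemma wp_cong [cong]: "s = s' \<Longrightarrow> t = t' \<Longrightarrow> wp c Q s t = wp c Q s' t'"
  by simp

lemma wp_Skip [simp]: "wp Skip Q s t \<longleftrightarrow> Q s (t + 1)"
  unfolding wp_def by (metis SkipE exec.Skip)

lemma wp_ISet [simp]:
  "wp (ISet a e f) Q s t \<longleftrightarrow> Q (ix_write a (ival e s) (ival f s) s) (t + (1 + itime e + itime f))"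
  unfolding wp_def by (metis ISetE exec.ISet)

lemma wp_RSet [simp]:
  "wp (RSet a e f) Q s t \<longleftrightarrow> Q (re_write a (ival e s) (rval f s) s) (t + (1 + itime e + rtime f))"
  unfolding wp_def by (metis RSetE exec.RSet)

lemma wp_Seq [simp]: "wp (Seq c d) Q s t \<longleftrightarrow> wp c (\<lambda>s t. wp d Q s t) s t"
  unfolding wp_def
  by (auto elim!: SeqE simp: add.assoc intro: exec.Seq)

lemma wp_If [simp]:
  "wp (If g c d) Q s t \<longleftrightarrow>
     (if bval g s then wp c Q s (t + (1 + btime g)) else wp d Q s (t + (1 + btime g)))"
proof (cases "bval g s")
  case True
  then have "exec (If g c d) s u s' \<longleftrightarrow> (\<exists>v. u = 1 + btime g + v \<and> exec c s v s')" for u s'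
    by (auto elim!: IfE intro: exec.IfTrue[simplified])
  then have "wp (If g c d) Q s t \<longleftrightarrow> (\<exists>v s'. exec c s v s' \<and> Q s' (t + (1 + btime g + v)))"
    by (simp only: wp_def) blast
  with True show ?thesis
    by (simp add: wp_def add.assoc)
next
  case False
  then have "exec (If g c d) s u s' \<longleftrightarrow> (\<exists>v. u = 1 + btime g + v \<and> exec d s v s')" for u s'
    by (auto elim!: IfE intro: exec.IfFalse[simplified])
  then have "wp (If g c d) Q s t \<longleftrightarrow> (\<exists>v s'. exec d s v s' \<and> Q s' (t + (1 + btime g + v)))"
    by (simp only: wp_def) blast
  with False show ?thesis
    by (simp add: wp_def add.assoc)
qed

lemma wp_mono: "wp c Q s t \<Longrightarrow> (\<And>s' t'. Q s' t' \<Longrightarrow> Q' s' t') \<Longrightarrow> wp c Q' s t"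
  unfolding wp_def by blast

text \<open>The measure \<open>n\<close> is an argument of the invariant, so termination and the
  time bound come out of the same induction.\<close>

lemma wp_While:
  fixes I :: "nat \<Rightarrow> state \<Rightarrow> nat \<Rightarrow> bool"
  assumes "I n s t"
    and body: "\<And>n s t. I n s t \<Longrightarrow> bval g s \<Longrightarrow>
      wp c (\<lambda>s' t'. \<exists>n'<n. I n' s' t') s (t + (1 + btime g))"
    and exit: "\<And>n s t. I n s t \<Longrightarrow> \<not> bval g s \<Longrightarrow> Q s (t + (1 + btime g))"
  shows "wp (While g c) Q s t"
  using assms(1)
proof (induction n arbitrary: s t rule: less_induct)
  case (less n)
  show ?case
  proof (cases "bval g s")
    case True
    from body[OF less.prems True] obtain u s' n'
      where u: "exec c s u s'" and n': "n' < n" "I n' s' (t + (1 + btime g) + u)"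
      unfolding wp_def by blast
    from less.IH[OF n'] obtain u' s''
      where "exec (While g c) s' u' s''" "Q s'' (t + (1 + btime g) + u + u')"
      unfolding wp_def by blast
    with exec.WhileTrue[OF True u] show ?thesis
      unfolding wp_def by (metis add.assoc)
  next
    case False
    with exit[OF less.prems False] exec.WhileFalse[OF False] show ?thesis
      unfolding wp_def by blast
  qed
qed

primrec iwrites :: "com \<Rightarrow> vname set" where
  "iwrites Skip = {}"
| "iwrites (ISet a e f) = {a}"
| "iwrites (RSet a e f) = {}"
| "iwrites (Seq c d) = iwrites c \<union> iwrites d"
| "iwrites (If g c d) = iwrites c \<union> iwrites d"
| "iwrites (While g c) = iwrites c"

primrec rwrites :: "com \<Rightarrow> vname set" where
  "rwrites Skip = {}"
| "rwrites (ISet a e f) = {}"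
| "rwrites (RSet a e f) = {a}"
| "rwrites (Seq c d) = rwrites c \<union> rwrites d"
| "rwrites (If g c d) = rwrites c \<union> rwrites d"
| "rwrites (While g c) = rwrites c"

lemma exec_frame:
  "exec c s t s' \<Longrightarrow>
     (\<forall>a. a \<notin> iwrites c \<longrightarrow> ix s' a = ix s a) \<and> (\<forall>a. a \<notin> rwrites c \<longrightarrow> re s' a = re s a)"
  by (induction rule: exec.induct) (auto simp: ix_write_def re_write_def)

text \<open>Lets postconditions omit untouched arrays: what a program cannot write is read off its
  syntax.\<close>

lemma wp_frame:
  assumes "wp c Q s t"
    and "\<And>s' t'. Q s' t' \<Longrightarrow> \<forall>a. a \<notin> iwrites c \<longrightarrow> ix s' a = ix s a \<Longrightarrow>
      \<forall>a. a \<notin> rwrites c \<longrightarrow> re s' a = re s a \<Longrightarrow> Q' s' t'"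
  shows "wp c Q' s t"
  using assms exec_frame unfolding wp_def by blast

lemma ix_ix_write [simp]:
  "ix (ix_write a k v s) b = (if b = a then (ix s b)(k := v) else ix s b)"
  by (simp add: ix_write_def)

lemma re_ix_write [simp]: "re (ix_write a k v s) = re s"
  by (simp add: ix_write_def)

lemma re_re_write [simp]:
  "re (re_write a k v s) b = (if b = a then (re s b)(k := v) else re s b)"
  by (simp add: re_write_def)

lemma ix_re_write [simp]: "ix (re_write a k v s) = ix s"
  by (simp add: re_write_def)

abbreviation iscal :: "vname \<Rightarrow> iexp" where "iscal a \<equiv> IGet a (IConst 0)"
abbreviation rscal :: "vname \<Rightarrow> rexp" where "rscal a \<equiv> RGet a (IConst 0)"
abbreviation iput :: "vname \<Rightarrow> iexp \<Rightarrow> com" where "iput a e \<equiv> ISet a (IConst 0) e"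
abbreviation rput :: "vname \<Rightarrow> rexp \<Rightarrow> com" where "rput a e \<equiv> RSet a (IConst 0) e"


section \<open>Tournament trees\<close>

text \<open>The leaves \<open>d, \<dots>, 2 * d - 1\<close> carry the keys; node \<open>i < d\<close> holds the smaller key of its children
  \<open>2 * i\<close> and \<open>2 * i + 1\<close> together with the leaf number it came from.\<close>

definition node_ok :: "(nat \<Rightarrow> real) \<Rightarrow> (nat \<Rightarrow> nat) \<Rightarrow> nat \<Rightarrow> bool" where
  "node_ok V A i \<longleftrightarrow>
     (if V (i + i + 1) < V (i + i) then V i = V (i + i + 1) \<and> A i = A (i + i + 1)
      else V i = V (i + i) \<and> A i = A (i + i))"

definition leaves_ok :: "nat \<Rightarrow> (nat \<Rightarrow> nat) \<Rightarrow> bool" where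
  "leaves_ok d A \<longleftrightarrow> (\<forall>l<d. A (d + l) = l)"

definition tree_ok :: "nat \<Rightarrow> (nat \<Rightarrow> real) \<Rightarrow> (nat \<Rightarrow> nat) \<Rightarrow> bool" where
  "tree_ok d V A \<longleftrightarrow> (\<forall>i. 1 \<le> i \<and> i < d \<longrightarrow> node_ok V A i) \<and> leaves_ok d A"

text \<open>Children have larger indices than their parent, so the induction runs from the leaves
  up. \<open>d\<close> need not be a power of two: the children of a node below \<open>d\<close>
  still lie below \<open>2 * d\<close>.\<close>

lemma tree_ok_arg:
  assumes "tree_ok d V A" "1 \<le> i" "i < 2 * d"
  shows "A i < d \<and> V (d + A i) = V i"
  using assms(2,3)
proof (induction "2 * d - i" arbitrary: i rule: less_induct)
  case less
  show ?case
  proof (cases "i < d")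
    case True
    then have "node_ok V A i"
      using assms(1) less.prems by (simp add: tree_ok_def)
    moreover have "A (i + i) < d \<and> V (d + A (i + i)) = V (i + i)"
      by (rule less.hyps) (use less.prems True in auto)
    moreover have "A (i + i + 1) < d \<and> V (d + A (i + i + 1)) = V (i + i + 1)"
      by (rule less.hyps) (use less.prems True in auto)
    ultimately show ?thesis
      by (auto simp: node_ok_def split: if_splits)
  next
    case False
    then obtain l where "i = d + l" "l < d"
      using less.prems by (metis add_less_cancel_left le_Suc_ex mult_2 not_less)
    then show ?thesis
      using assms(1) by (simp add: tree_ok_def leaves_ok_def)
  qed
qed

text \<open>Halving the index leads from any node to node \<open>1\<close>, and keys never increase
  on the way.\<close>

lemma tree_ok_root_le:
  assumes "tree_ok d V A" "1 \<le> i" "i < 2 * d"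
  shows "V 1 \<le> V i"
  using assms(2,3)
proof (induction i rule: less_induct)
  case (less i)
  show ?case
  proof (cases "i = 1")
    case False
    then have h: "1 \<le> i div 2" "i div 2 < d" "i div 2 < i"
      using less.prems by auto
    then have "node_ok V A (i div 2)"
      using assms(1) by (simp add: tree_ok_def)
    moreover have "i = i div 2 + i div 2 \<or> i = i div 2 + i div 2 + 1"
      by presburger
    ultimately have "V (i div 2) \<le> V i"
      unfolding node_ok_def by (smt (verit, best))
    with less.IH[OF h(3) h(1)] h(2) show ?thesis
      by simp
  qed simp
qed

lemma tree_ok_root:
  assumes "tree_ok d V A" "1 \<le> d"
  shows "A 1 < d" "V (d + A 1) = V 1" "\<And>l. l < d \<Longrightarrow> V 1 \<le> V (d + l)"
  using tree_ok_arg[OF assms(1), of 1] tree_ok_root_le[OF assms(1)] assms(2) by auto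

definition fix_node :: "vname \<Rightarrow> com" where
  "fix_node a =
     (let i = iscal ''i''; l = IAdd i i; r = IAdd (IAdd i i) (IConst 1) in
      If (RLess (RGet a r) (RGet a l))
        (Seq (RSet a i (RGet a r)) (ISet a i (IGet a r)))
        (Seq (RSet a i (RGet a l)) (ISet a i (IGet a l))))"

definition build_tree :: "vname \<Rightarrow> com" where
  "build_tree a =
     Seq (iput ''i'' (ISub (iscal ''d'') (IConst 1)))
     (While (ILess (IConst 0) (iscal ''i''))
       (Seq (fix_node a) (iput ''i'' (ISub (iscal ''i'') (IConst 1)))))"

definition update_tree :: "vname \<Rightarrow> com" where
  "update_tree a =
     Seq (iput ''i'' (IHalf (IAdd (iscal ''d'') (iscal ''j''))))
     (While (ILess (IConst 0) (iscal ''i''))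
       (Seq (fix_node a) (iput ''i'' (IHalf (iscal ''i'')))))"

lemma iwrites_tree [simp]:
  "iwrites (build_tree a) = {''i'', a}" "iwrites (update_tree a) = {''i'', a}"
  "rwrites (build_tree a) = {a}" "rwrites (update_tree a) = {a}"
  by (auto simp: build_tree_def update_tree_def fix_node_def Let_def)

lemma wp_fix_node:
  assumes "ix s ''i'' 0 = i" "1 \<le> i" "a \<noteq> ''i''"
    and Q: "\<And>s' t'. node_ok (re s' a) (ix s' a) i \<Longrightarrow>
      (\<forall>k. k \<noteq> i \<longrightarrow> re s' a k = re s a k \<and> ix s' a k = ix s a k) \<Longrightarrow>
      (\<forall>b. b \<noteq> a \<longrightarrow> re s' b = re s b \<and> ix s' b = ix s b) \<Longrightarrow> t' \<le> t + 40 \<Longrightarrow> Q s' t'"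
  shows "wp (fix_node a) Q s t"
  unfolding fix_node_def Let_def using assms(1-3)
  by (simp, intro conjI impI; intro Q; simp add: node_ok_def)

lemma wp_build_tree:
  assumes d: "ix s ''d'' 0 = d" "1 \<le> d" "a \<noteq> ''i''" "a \<noteq> ''d''" "leaves_ok d (ix s a)"
    and Q: "\<And>s' t'. tree_ok d (re s' a) (ix s' a) \<Longrightarrow> \<forall>l<d. re s' a (d + l) = re s a (d + l) \<Longrightarrow>
      (\<forall>b. b \<noteq> a \<longrightarrow> re s' b = re s b) \<Longrightarrow>
      (\<forall>b. b \<noteq> a \<longrightarrow> b \<noteq> ''i'' \<longrightarrow> ix s' b = ix s b) \<Longrightarrow> t' \<le> t + 60 * d \<Longrightarrow> Q s' t'"
  shows "wp (build_tree a) Q s t"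
proof -
  let ?I = "\<lambda>n s' t'. n = ix s' ''i'' 0 \<and> n < d \<and>
      (\<forall>i. n < i \<and> i < d \<longrightarrow> node_ok (re s' a) (ix s' a) i) \<and>
      (\<forall>k\<ge>d. re s' a k = re s a k \<and> ix s' a k = ix s a k) \<and>
      (\<forall>b. b \<noteq> a \<longrightarrow> re s' b = re s b) \<and> (\<forall>b. b \<noteq> a \<longrightarrow> b \<noteq> ''i'' \<longrightarrow> ix s' b = ix s b) \<and>
      t' + 60 * n + 50 \<le> t + 60 * d"
  show ?thesis
    unfolding build_tree_def wp_Seq wp_ISet
  proof (rule wp_While[where I = ?I and n = "d - 1"])
    fix n s1 t1
    assume I: "?I n s1 t1" and g: "bval (ILess (IConst 0) (iscal ''i'')) s1"
    show "wp (Seq (fix_node a) (iput ''i'' (ISub (iscal ''i'') (IConst 1))))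
       (\<lambda>s' t'. \<exists>n'<n. ?I n' s' t') s1 (t1 + (1 + btime (ILess (IConst 0) (iscal ''i''))))"
      unfolding wp_Seq
    proof (rule wp_fix_node[where i = n], goal_cases)
      case (4 s2 t2)
      have "node_ok (re s2 a) (ix s2 a) i" if "n \<le> i" "i < d" for i
      proof (cases "i = n")
        case False
        then have "node_ok (re s1 a) (ix s1 a) i"
          using I that by simp
        then show ?thesis
          using 4(2) that False by (simp add: node_ok_def)
      qed (use 4(1) in simp)
      then show ?case
        using I g 4 d by (auto intro!: exI[of _ "n - 1"] simp: fun_upd_def)
    qed (use I g d in auto)
  next
    fix n s1 t1
    assume "?I n s1 t1" "\<not> bval (ILess (IConst 0) (iscal ''i'')) s1"
    then show "Q s1 (t1 + (1 + btime (ILess (IConst 0) (iscal ''i''))))"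
      using d by (intro Q) (auto simp: tree_ok_def leaves_ok_def)
  qed (use d in auto)
qed

text \<open>\<open>v\<close> is a key of leaf \<open>j\<close> for which the tree was correct before
  the leaf was overwritten. Hence only the parent of the leaf can violate \<open>node_ok\<close>,
  and repairing a node can spoil only its own parent.\<close>

lemma wp_update_tree:
  assumes d: "ix s ''d'' 0 = d" "1 \<le> d" "ix s ''j'' 0 = j" "j < d" "2 * d \<le> 2 ^ lg"
      "a \<notin> {''i'', ''d'', ''j''}"
    and ok: "tree_ok d ((re s a)(d + j := v)) (ix s a)"
    and Q: "\<And>s' t'. tree_ok d (re s' a) (ix s' a) \<Longrightarrow> \<forall>l<d. re s' a (d + l) = re s a (d + l) \<Longrightarrow>
      (\<forall>b. b \<noteq> a \<longrightarrow> re s' b = re s b) \<Longrightarrow>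
      (\<forall>b. b \<noteq> a \<longrightarrow> b \<noteq> ''i'' \<longrightarrow> ix s' b = ix s b) \<Longrightarrow> t' \<le> t + 60 * lg + 60 \<Longrightarrow> Q s' t'"
  shows "wp (update_tree a) Q s t"
proof -
  \<comment> \<open>Node \<open>n\<close> is the only one that may be wrong; \<open>m\<close> bounds
    the halvings left until the index is \<open>0\<close>.\<close>
  let ?I = "\<lambda>n s' t'. n = ix s' ''i'' 0 \<and> n < d \<and>
      (\<forall>i. 1 \<le> i \<and> i < d \<and> i \<noteq> n \<longrightarrow> node_ok (re s' a) (ix s' a) i) \<and>
      (\<forall>k\<ge>d. re s' a k = re s a k \<and> ix s' a k = ix s a k) \<and>
      (\<forall>b. b \<noteq> a \<longrightarrow> re s' b = re s b) \<and> (\<forall>b. b \<noteq> a \<longrightarrow> b \<noteq> ''i'' \<longrightarrow> ix s' b = ix s b) \<and>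
      (\<exists>m. n < 2 ^ m \<and> t' + 60 * m + 40 \<le> t + 60 * lg + 60)"
  have init: "node_ok (re s a) (ix s a) i" if "1 \<le> i" "i < d" "i \<noteq> (d + j) div 2" for i
  proof -
    have "node_ok ((re s a)(d + j := v)) (ix s a) i"
      using ok that by (simp add: tree_ok_def)
    moreover have "i + i \<noteq> d + j" "i + i + 1 \<noteq> d + j" "i \<noteq> d + j"
      using that by auto
    ultimately show ?thesis
      by (auto simp: node_ok_def split: if_splits)
  qed
  show ?thesis
    unfolding update_tree_def wp_Seq wp_ISet
  proof (rule wp_While[where I = ?I and n = "(d + j) div 2"])
    fix n s1 t1
    assume I: "?I n s1 t1" and g: "bval (ILess (IConst 0) (iscal ''i'')) s1"
    then obtain m where m: "n < 2 ^ m" "t1 + 60 * m + 40 \<le> t + 60 * lg + 60"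
      by blast
    from g I have "0 < n" by simp
    with m obtain m' where m': "m = Suc m'"
      by (cases m) auto
    show "wp (Seq (fix_node a) (iput ''i'' (IHalf (iscal ''i''))))
       (\<lambda>s' t'. \<exists>n'<n. ?I n' s' t') s1 (t1 + (1 + btime (ILess (IConst 0) (iscal ''i''))))"
      unfolding wp_Seq
    proof (rule wp_fix_node[where i = n], goal_cases)
      case (4 s2 t2)
      have "node_ok (re s2 a) (ix s2 a) i" if "1 \<le> i" "i < d" "i \<noteq> n div 2" for i
      proof (cases "i = n")
        case False
        then have "node_ok (re s1 a) (ix s1 a) i"
          using I that by simp
        moreover have "i + i \<noteq> n" "i + i + 1 \<noteq> n"
          using that by auto
        ultimately show ?thesis
          using 4(2) that False by (simp add: node_ok_def)
      qed (use 4(1) in simp)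
      moreover have "n div 2 < 2 ^ m'"
        using m m' by simp
      ultimately show ?case
        using I g 4 d m m' \<open>0 < n\<close>
        by (auto intro!: exI[of _ "n div 2"] exI[of _ m'] simp: fun_upd_def)
    qed (use I g d in auto)
  next
    fix n s1 t1
    assume "?I n s1 t1" "\<not> bval (ILess (IConst 0) (iscal ''i'')) s1"
    then show "Q s1 (t1 + (1 + btime (ILess (IConst 0) (iscal ''i''))))"
      using d ok by (intro Q) (auto simp: tree_ok_def leaves_ok_def)
  qed (use d init in \<open>auto intro!: exI[of _ lg]\<close>)
qed


section \<open>Least step size for one row\<close>

text \<open>Local indices \<open>l < d\<close> number the entries of one row; \<open>u\<close> is the upper bound, rounded down for the
  integer variables \<open>J\<close>, and \<open>big\<close> is the key of a variable that has no further event.\<close>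

locale row =
  fixes d :: nat and a c x u :: "nat \<Rightarrow> real" and J :: "nat set" and b big :: real
  assumes a_pos: "l < d \<Longrightarrow> 0 < a l"
    and c_nonneg: "l < d \<Longrightarrow> 0 \<le> c l"
    and J_sub: "J \<subseteq> {..<d}"
    and u_int: "l \<in> J \<Longrightarrow> u l \<in> \<int>"
    and big_nonneg: "0 \<le> big"
    and big_gt: "l < d \<Longrightarrow> c l * (u l - x l) < big"
    and coverable: "b \<le> (\<Sum>l<d. a l * u l)"
begin

definition level :: "nat \<Rightarrow> real \<Rightarrow> real" where
  "level l t = (if c l = 0 then u l else min (x l + t / c l) (u l))"

definition total :: "real \<Rightarrow> real" where
  "total t = (\<Sum>l<d. a l * (if l \<in> J then of_int \<lfloor>level l t\<rfloor> else level l t))"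

text \<open>At time \<open>t\<close> a variable is credited with \<open>x l + t / c l\<close> if \<open>md l = 0\<close> (integrality and upper bound
  relaxed) and with the constant \<open>n l\<close> otherwise, so the credited left-hand side is
  \<open>offset md n + rate md * t\<close>. \<open>R\<close> is the set of integer variables not yet made discrete.\<close>

definition offset :: "(nat \<Rightarrow> nat) \<Rightarrow> (nat \<Rightarrow> real) \<Rightarrow> real" where
  "offset md n = (\<Sum>l<d. if md l = 0 then a l * x l else a l * n l)"

definition rate :: "(nat \<Rightarrow> nat) \<Rightarrow> real" where
  "rate md = (\<Sum>l<d. if md l = 0 then a l / c l else 0)"

definition credit :: "(nat \<Rightarrow> nat) \<Rightarrow> (nat \<Rightarrow> real) \<Rightarrow> real \<Rightarrow> nat \<Rightarrow> real" where
  "credit md n T l =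
     (if md l = 0 then if l \<in> J then of_int \<lfloor>x l + T / c l\<rfloor> else x l + T / c l else n l)"

definition slack :: "(nat \<Rightarrow> nat) \<Rightarrow> (nat \<Rightarrow> real) \<Rightarrow> real \<Rightarrow> real" where
  "slack md n T = b - (\<Sum>l<d. a l * credit md n T l)"

text \<open>The disjunct \<open>c l = 0\<close> covers free variables, for which
  \<open>T / c l\<close> evaluates to \<open>0\<close>.\<close>

definition saturated :: "(nat \<Rightarrow> real) \<Rightarrow> (nat \<Rightarrow> real) \<Rightarrow> real \<Rightarrow> nat \<Rightarrow> bool" where
  "saturated ky n T l \<longleftrightarrow> ky l = big \<and> n l = u l \<and> (c l = 0 \<or> u l \<le> x l + T / c l)"

text \<open>The key is the time at which \<open>x l + t / c l\<close> reaches
  \<open>n l + 1\<close>; once \<open>n l + 1\<close> exceeds \<open>u l\<close>, the variable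
  counts as \<open>saturated\<close> instead.\<close>

definition pending :: "(nat \<Rightarrow> real) \<Rightarrow> (nat \<Rightarrow> real) \<Rightarrow> nat set \<Rightarrow> real \<Rightarrow> nat \<Rightarrow> bool" where
  "pending ky n R T l \<longleftrightarrow> l \<in> J - R \<and> 0 < c l \<and> n l \<in> \<int> \<and> n l \<le> x l + T / c l \<and>
     n l + 1 \<le> u l \<and> ky l = c l * (n l + 1 - x l)"

text \<open>The clause over \<open>t\<close> keeps \<open>T\<close> a lower bound on the answer, so
  that stopping only requires that \<open>T\<close> suffices. An integer variable may stay in
  \<open>R\<close> after it has reached its upper bound; it leaves only by a move, and moves go by
  decreasing coefficient.\<close>

definition inv :: "(nat \<Rightarrow> nat) \<Rightarrow> (nat \<Rightarrow> real) \<Rightarrow> (nat \<Rightarrow> real) \<Rightarrow> nat set \<Rightarrow> real \<Rightarrow> bool" where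
  "inv md ky n R T \<longleftrightarrow> 0 \<le> T \<and> R \<subseteq> J \<and>
     (\<forall>l<d. T \<le> ky l) \<and>
     (\<forall>l<d. md l = 0 \<longrightarrow> 0 < c l \<and> x l < u l \<and> ky l = c l * (u l - x l) \<and> (l \<in> J \<longrightarrow> l \<in> R)) \<and>
     (\<forall>l<d. md l \<noteq> 0 \<longrightarrow> saturated ky n T l \<or> pending ky n R T l) \<and>
     (\<forall>t\<ge>0. b \<le> total t \<longrightarrow> T \<le> t) \<and>
     (\<forall>j\<in>J - R. \<forall>k\<in>R. a k \<le> a j)"

text \<open>Bounds the number of integer events: each of them reduces the slack by at least the least
  coefficient outside \<open>R\<close>, hence to at most \<open>sum a R\<close>, after which \<open>R\<close> can lose its largest element.\<close>

definition slack_inv :: "(nat \<Rightarrow> nat) \<Rightarrow> (nat \<Rightarrow> real) \<Rightarrow> nat set \<Rightarrow> real \<Rightarrow> bool" where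
  "slack_inv md n R T \<longleftrightarrow> (\<forall>j\<in>J - R. slack md n T \<le> sum a R + a j)"

lemma invD:
  assumes "inv md ky n R T"
  shows "0 \<le> T" "R \<subseteq> J" "\<And>l. l < d \<Longrightarrow> T \<le> ky l"
    "\<And>l. l < d \<Longrightarrow> md l = 0 \<Longrightarrow> 0 < c l \<and> x l < u l \<and> ky l = c l * (u l - x l) \<and> (l \<in> J \<longrightarrow> l \<in> R)"
    "\<And>l. l < d \<Longrightarrow> md l \<noteq> 0 \<Longrightarrow> saturated ky n T l \<or> pending ky n R T l"
    "\<And>t. 0 \<le> t \<Longrightarrow> b \<le> total t \<Longrightarrow> T \<le> t"
    "\<And>j k. j \<in> J - R \<Longrightarrow> k \<in> R \<Longrightarrow> a k \<le> a j"
  using assms unfolding inv_def by blast+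

lemma finite_J: "finite J"
  using J_sub finite_subset by blast

section \<open>Upper and lower estimates of the left-hand side\<close>

lemma le_line_iff: "0 < c l \<Longrightarrow> T \<le> c l * (v - x l) \<longleftrightarrow> x l + T / c l \<le> v"
  by (simp add: field_simps)

lemma less_line_iff: "0 < c l \<Longrightarrow> T < c l * (v - x l) \<longleftrightarrow> x l + T / c l < v"
  by (simp add: field_simps)

lemma line_mono: "l < d \<Longrightarrow> T \<le> T' \<Longrightarrow> x l + T / c l \<le> x l + T' / c l"
  using c_nonneg by (simp add: divide_right_mono)

lemma rate_nonneg: "0 \<le> rate md"
  unfolding rate_def using a_pos c_nonneg by (intro sum_nonneg) (simp add: less_imp_le)

lemma account_eq: "offset md n + rate md * t =
    (\<Sum>l<d. a l * (if md l = 0 then x l + t / c l else n l))"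
  unfolding offset_def rate_def sum_distrib_right sum.distrib[symmetric]
  by (intro sum.cong) (auto simp: algebra_simps)

text \<open>Before the next event no saturated or pending variable contributes more than its
  constant \<open>n l\<close>, and a relaxed one is overestimated because its rounding and its upper
  bound are ignored.\<close>

lemma total_le_account:
  assumes inv: "inv md ky n R T" and t: "\<And>l. l < d \<Longrightarrow> t < ky l"
  shows "total t \<le> offset md n + rate md * t"
  unfolding account_eq total_def
proof (intro sum_mono mult_left_mono)
  fix l assume "l \<in> {..<d}"
  then have l: "l < d" by simp
  show "0 \<le> a l"
    using a_pos[OF l] by simp
  show "(if l \<in> J then of_int \<lfloor>level l t\<rfloor> else level l t) \<le> (if md l = 0 then x l + t / c l else n l)"
  proof (cases "md l = 0")
    case True
    then have "level l t \<le> x l + t / c l"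
      using invD(4)[OF inv l] by (simp add: level_def)
    then show ?thesis
      using True by (auto intro: order_trans[OF of_int_floor_le])
  next
    case False
    have lu: "level l t \<le> u l"
      by (simp add: level_def)
    from invD(5)[OF inv l False] show ?thesis
    proof
      assume "saturated ky n T l"
      then show ?thesis
        using False lu by (auto simp: saturated_def intro: order_trans[OF of_int_floor_le])
    next
      assume p: "pending ky n R T l"
      then have "x l + t / c l < n l + 1"
        using t[OF l] less_line_iff[of l t "n l + 1"] by (simp add: pending_def)
      moreover obtain m where "n l = of_int m"
        using p Ints_cases unfolding pending_def by blast
      moreover have "level l t \<le> x l + t / c l"
        using p by (simp add: level_def pending_def)
      ultimately have "\<lfloor>level l t\<rfloor> < m + 1"
        unfolding floor_less_iff by simp
      then show ?thesis
        using False p \<open>n l = of_int m\<close> by (simp add: pending_def)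
    qed
  qed
qed

text \<open>The opposite estimate. The key of a relaxed variable is the time at which it meets its
  upper bound, so at \<open>T\<close> the bound is not yet exceeded and the rounded credit is exact;
  a discrete variable is credited only with what it has reached.\<close>

lemma credit_le_total:
  assumes inv: "inv md ky n R T"
  shows "(\<Sum>l<d. a l * credit md n T l) \<le> total T"
  unfolding total_def
proof (intro sum_mono mult_left_mono)
  fix l assume "l \<in> {..<d}"
  then have l: "l < d" by simp
  show "0 \<le> a l"
    using a_pos[OF l] by simp
  show "credit md n T l \<le> (if l \<in> J then of_int \<lfloor>level l T\<rfloor> else level l T)"
  proof (cases "md l = 0")
    case True
    then have "level l T = x l + T / c l"
      using invD(3,4)[OF inv l] le_line_iff[of l T "u l"] by (simp add: level_def)
    then show ?thesis
      using True by (simp add: credit_def)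
  next
    case False
    from invD(5)[OF inv l False] show ?thesis
    proof
      assume "saturated ky n T l"
      then have "level l T = n l" "n l = u l"
        by (auto simp: saturated_def level_def)
      then show ?thesis
        using False u_int[of l] by (auto simp: credit_def elim: Ints_cases)
    next
      assume p: "pending ky n R T l"
      then have "n l \<le> level l T"
        by (simp add: level_def pending_def)
      moreover obtain m where m: "n l = of_int m"
        using p Ints_cases unfolding pending_def by blast
      ultimately have "m \<le> \<lfloor>level l T\<rfloor>"
        by (simp add: le_floor_iff)
      then show ?thesis
        using False p m by (simp add: pending_def credit_def)
    qed
  qed
qed

section \<open>Advancing the time between events\<close>

lemma inv_advance:
  assumes inv: "inv md ky n R T" and "T \<le> T'" "\<And>l. l < d \<Longrightarrow> T' \<le> ky l"
    and "\<And>t. 0 \<le> t \<Longrightarrow> b \<le> total t \<Longrightarrow> T' \<le> t"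
  shows "inv md ky n R T'"
proof -
  have "saturated ky n T' l \<or> pending ky n R T' l" if "l < d" "md l \<noteq> 0" for l
    using invD(5)[OF inv that] line_mono[OF that(1) assms(2)]
    by (auto simp: saturated_def pending_def)
  then show ?thesis
    using assms unfolding inv_def by auto
qed

lemma slack_antimono: "T \<le> T' \<Longrightarrow> slack md n T' \<le> slack md n T"
  unfolding slack_def
proof (intro diff_left_mono sum_mono mult_left_mono)
  fix l assume "T \<le> T'" "l \<in> {..<d}"
  then show "credit md n T l \<le> credit md n T' l" "0 \<le> a l"
    using line_mono[of l T T'] a_pos[of l] by (auto simp: credit_def intro: floor_mono)
qed

text \<open>A sufficient \<open>t\<close> before \<open>\<tau>\<close> would have its total bounded
  by the line, which is nondecreasing and still short of \<open>b\<close> at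
  \<open>\<tau>\<close>.\<close>

lemma advance_to_event:
  assumes inv: "inv md ky n R T" and \<tau>: "\<And>l. l < d \<Longrightarrow> \<tau> \<le> ky l" "\<tau> \<in> ky ` {..<d}"
    and less: "offset md n + rate md * \<tau> < b"
  shows "inv md ky n R \<tau>" "T \<le> \<tau>"
proof -
  show T: "T \<le> \<tau>"
    using \<tau>(2) invD(3)[OF inv] by auto
  have "\<tau> \<le> t" if "b \<le> total t" for t
  proof (rule ccontr)
    assume "\<not> \<tau> \<le> t"
    then have "total t \<le> offset md n + rate md * t"
      using \<tau>(1) by (intro total_le_account[OF inv]) fastforce
    also have "\<dots> \<le> offset md n + rate md * \<tau>"
      using \<open>\<not> \<tau> \<le> t\<close> rate_nonneg by (simp add: mult_left_mono)
    finally show False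
      using less that by simp
  qed
  then show "inv md ky n R \<tau>"
    using \<tau> T by (intro inv_advance[OF inv]) auto
qed

text \<open>Integrality is relaxed only for \<open>R\<close>, and rounding down loses less than one unit per variable.\<close>

lemma slack_le_relaxed:
  assumes inv: "inv md ky n R T" and ge: "b \<le> offset md n + rate md * T"
  shows "slack md n T \<le> sum a R"
proof -
  have "slack md n T \<le> (\<Sum>l<d. a l * (if md l = 0 then x l + T / c l else n l)) - (\<Sum>l<d. a l * credit md n T l)"
    using ge unfolding account_eq slack_def by simp
  also have "\<dots> = (\<Sum>l<d. a l * ((if md l = 0 then x l + T / c l else n l) - credit md n T l))"
    by (simp add: sum_subtractf right_diff_distrib)
  also have "\<dots> \<le> (\<Sum>l<d. if l \<in> R then a l else 0)"
  proof (intro sum_mono)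
    fix l assume "l \<in> {..<d}"
    then have l: "l < d" by simp
    have "a l * (x l + T / c l - of_int \<lfloor>x l + T / c l\<rfloor>) \<le> a l * 1"
      by (intro mult_left_mono) (use a_pos[OF l] in linarith)+
    then show "a l * ((if md l = 0 then x l + T / c l else n l) - credit md n T l) \<le> (if l \<in> R then a l else 0)"
      using invD(4)[OF inv l] a_pos[OF l] by (auto simp: credit_def)
  qed
  also have "\<dots> = sum a R"
    using invD(2)[OF inv] J_sub by (subst sum.inter_restrict[symmetric]) (auto intro!: sum.cong)
  finally show ?thesis .
qed

text \<open>\<open>T'\<close> is the time at which the line crosses \<open>b\<close>, or
  \<open>T\<close> itself if the line is there already, as after a move that rounds off
  nothing.\<close>

lemma advance_relaxed:
  assumes inv: "inv md ky n R T" and \<tau>: "\<And>l. l < d \<Longrightarrow> \<tau> \<le> ky l" "\<tau> \<in> ky ` {..<d}"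
    and ge: "b \<le> offset md n + rate md * \<tau>"
    and T': "T' = (if offset md n + rate md * T < b then (b - offset md n) / rate md else T)"
  shows "inv md ky n R T'" "slack md n T' \<le> sum a R"
proof -
  have "inv md ky n R T' \<and> b \<le> offset md n + rate md * T'"
  proof (cases "offset md n + rate md * T < b")
    case True
    have T\<tau>: "T \<le> \<tau>"
      using \<tau>(2) invD(3)[OF inv] by auto
    \<comment> \<open>The line is below \<open>b\<close> at \<open>T\<close> and at least
      \<open>b\<close> at \<open>\<tau>\<close>, so it is not constant.\<close>
    have pos: "0 < rate md"
      using True ge rate_nonneg[of md] by (cases "rate md = 0") auto
    have eq: "rate md * T' = b - offset md n"
      using True pos T' by simp
    have "rate md * T < rate md * T'" "rate md * T' \<le> rate md * \<tau>"
      using True ge eq by auto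
    then have le: "T \<le> T'" "T' \<le> \<tau>"
      using pos by auto
    have "T' \<le> t" if "b \<le> total t" for t
    proof (rule ccontr)
      assume "\<not> T' \<le> t"
      then have "total t \<le> offset md n + rate md * t"
        using \<tau>(1) le by (intro total_le_account[OF inv]) fastforce
      also have "\<dots> < offset md n + rate md * T'"
        using \<open>\<not> T' \<le> t\<close> pos by simp
      finally show False
        using eq that by simp
    qed
    then have "inv md ky n R T'"
      using \<tau> le by (intro inv_advance[OF inv]) force+
    then show ?thesis
      using eq by simp
  next
    case False
    then show ?thesis
      using inv T' by simp
  qed
  then show "inv md ky n R T'" "slack md n T' \<le> sum a R"
    using slack_le_relaxed by blast+
qed

section \<open>Effect of a single event on the invariant\<close>

definition next_key :: "nat \<Rightarrow> real \<Rightarrow> real" where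
  "next_key j v = (if c j * (u j - x j) < v then big else v)"

text \<open>Keeps \<open>T\<close> below all keys when a key is replaced by
  \<open>big\<close>.\<close>

lemma time_le_big:
  assumes inv: "inv md ky n R T" and l: "l < d"
  shows "T \<le> big"
proof -
  have "ky l \<le> big"
  proof (cases "md l = 0")
    case True
    then show ?thesis
      using invD(4)[OF inv l] big_gt[OF l] by simp
  next
    case False
    from invD(5)[OF inv l False] show ?thesis
    proof
      assume p: "pending ky n R T l"
      then have "c l * (n l + 1 - x l) \<le> c l * (u l - x l)"
        by (simp add: pending_def)
      with p big_gt[OF l] show ?thesis
        unfolding pending_def by linarith
    qed (simp add: saturated_def)
  qed
  with invD(3)[OF inv l] show ?thesis
    by simp
qed

text \<open>Common core of the three events: \<open>v\<close> is \<open>u j\<close> at a saturation,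
  \<open>n j + 1\<close> at an integer event, and the rounded-down position at a move, where
  \<open>R'\<close> is \<open>R - {j}\<close>. The first two bounds on \<open>v\<close> say that
  \<open>T\<close> lies between the times at which \<open>j\<close> reaches \<open>v\<close> and
  \<open>v + 1\<close>.\<close>

lemma inv_settle:
  assumes inv: "inv md ky n R T" and j: "j < d" "0 < c j"
    and v: "v \<le> x j + T / c j" "x j + T / c j \<le> v + 1" "v \<le> u j"
      "v = u j \<or> j \<in> J - R' \<and> v \<in> \<int>"
    and R': "R' \<subseteq> R" "R - {j} \<subseteq> R'" "\<And>i k. i \<in> J - R' \<Longrightarrow> k \<in> R' \<Longrightarrow> a k \<le> a i"
  shows "inv (md(j := 1)) (ky(j := next_key j (c j * (v + 1 - x j)))) (n(j := v)) R' T"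
proof -
  let ?k = "next_key j (c j * (v + 1 - x j))"
  have Tk: "T \<le> c j * (v + 1 - x j)"
    using v(2) le_line_iff[OF j(2), of T "v + 1"] by (simp add: algebra_simps)
  have cases: "saturated (ky(j := ?k)) (n(j := v)) T j \<or> pending (ky(j := ?k)) (n(j := v)) R' T j"
  proof (cases "u j < v + 1")
    case True
    \<comment> \<open>Two integers with \<open>v \<le> u j < v + 1\<close> coincide, so a discrete
      variable without a further integer below its bound sits exactly at the bound.\<close>
    have "v = u j"
      using v(4)
    proof
      assume h: "j \<in> J - R' \<and> v \<in> \<int>"
      then obtain p q where "v = of_int p" "u j = of_int q"
        using u_int[of j] by (auto elim!: Ints_cases)
      with True v(3) show ?thesis
        by simp
    qed
    moreover have "c j * (u j - x j) < c j * (v + 1 - x j)"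
      using True j by simp
    ultimately show ?thesis
      using v by (simp add: saturated_def next_key_def)
  next
    case False
    then have "\<not> c j * (u j - x j) < c j * (v + 1 - x j)"
      using j by simp
    then show ?thesis
      using v j False by (auto simp: pending_def next_key_def)
  qed
  have "T \<le> ?k"
    using Tk time_le_big[OF inv j(1)] by (simp add: next_key_def)
  moreover have "saturated (ky(j := ?k)) (n(j := v)) T l \<or> pending (ky(j := ?k)) (n(j := v)) R' T l"
    if "l < d" "md l \<noteq> 0" "l \<noteq> j" for l
    using invD(5)[OF inv that(1,2)] that(3) R'(1) by (auto simp: saturated_def pending_def)
  ultimately show ?thesis
    using inv R' cases unfolding inv_def by (auto split: if_splits)
qed

lemma offset_upd:
  "j < d \<Longrightarrow> offset (md(j := 1)) (n(j := v)) =
     offset md n + a j * (v - (if md j = 0 then x j else n j))"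
  unfolding offset_def by (subst (1 2) sum.remove[of _ j]) (auto simp: algebra_simps intro!: sum.cong split: if_splits)

lemma rate_upd:
  "j < d \<Longrightarrow> rate (md(j := 1)) = rate md - (if md j = 0 then a j / c j else 0)"
  unfolding rate_def by (subst (1 2) sum.remove[of _ j]) (auto intro!: sum.cong split: if_splits)

lemma slack_upd:
  "j < d \<Longrightarrow> slack (md(j := 1)) (n(j := v)) T = slack md n T - a j * (v - credit md n T j)"
  unfolding slack_def
  by (subst (1 2) sum.remove[of _ j]) (auto simp: algebra_simps credit_def intro!: sum.cong split: if_splits)

text \<open>If the next event were at \<open>big\<close>, every variable would be saturated, and the
  line would equal the largest attainable left-hand side, which is at least \<open>b\<close> by
  \<open>coverable\<close>.\<close>

lemma event_not_big:
  assumes inv: "inv md ky n R T" and \<tau>: "\<And>l. l < d \<Longrightarrow> \<tau> \<le> ky l"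
    and less: "offset md n + rate md * \<tau> < b"
  shows "\<tau> \<noteq> big"
proof
  assume "\<tau> = big"
  have sat: "md l \<noteq> 0 \<and> n l = u l" if l: "l < d" for l
  proof -
    have "md l \<noteq> 0"
      using invD(4)[OF inv l] big_gt[OF l] \<tau>[OF l] \<open>\<tau> = big\<close> by fastforce
    moreover have "\<not> pending ky n R T l"
    proof
      assume p: "pending ky n R T l"
      then have "c l * (n l + 1 - x l) \<le> c l * (u l - x l)"
        by (simp add: pending_def)
      with p big_gt[OF l] \<tau>[OF l] \<open>\<tau> = big\<close> show False
        unfolding pending_def by linarith
    qed
    ultimately show ?thesis
      using invD(5)[OF inv l] by (auto simp: saturated_def)
  qed
  then have "offset md n + rate md * \<tau> = (\<Sum>l<d. a l * u l)"
    unfolding account_eq by (intro sum.cong refl) (simp add: sat)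
  then show False
    using less coverable by simp
qed

text \<open>At this time \<open>j\<close> meets \<open>u j\<close> exactly, and for integer
  \<open>j\<close> this is also its rounded value, so the slack does not change. An integer
  \<open>j\<close> remains in \<open>R\<close>.\<close>

lemma saturate_step:
  assumes inv: "inv md ky n R T" and j: "j < d" "md j = 0" "T = ky j" and sl: "slack_inv md n R T"
  shows "inv (md(j := 1)) (ky(j := next_key j (c j * (u j + 1 - x j)))) (n(j := u j)) R T"
    "slack_inv (md(j := 1)) (n(j := u j)) R T"
proof -
  have c: "0 < c j" "x j < u j" "T = c j * (u j - x j)"
    using invD(4)[OF inv j(1,2)] j by auto
  then have eq: "x j + T / c j = u j"
    by simp
  show "inv (md(j := 1)) (ky(j := next_key j (c j * (u j + 1 - x j)))) (n(j := u j)) R T"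
    by (rule inv_settle[OF inv j(1)]) (use eq c invD(7)[OF inv] in auto)
  have "credit md n T j = u j"
    using eq j(2) u_int[of j] by (auto simp: credit_def elim: Ints_cases)
  then show "slack_inv (md(j := 1)) (n(j := u j)) R T"
    using sl j(1) by (simp add: slack_inv_def slack_upd[unfolded One_nat_def])
qed

text \<open>\<open>j\<close> lies outside \<open>R\<close>, so \<open>slack_inv\<close> allows a
  slack of at most \<open>sum a R + a j\<close>, and the new integer pays for the
  \<open>a j\<close>. Adding \<open>c j\<close> to the key gives the time of the following
  integer.\<close>

lemma increment_step:
  assumes inv: "inv md ky n R T" and j: "j < d" "md j \<noteq> 0" "T = ky j" "ky j \<noteq> big"
    and sl: "slack_inv md n R T"
  shows "inv (md(j := 1)) (ky(j := next_key j (ky j + c j))) (n(j := n j + 1)) R T"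
    "slack (md(j := 1)) (n(j := n j + 1)) T \<le> sum a R"
proof -
  have p: "pending ky n R T j"
    using invD(5)[OF inv j(1,2)] j(4) by (auto simp: saturated_def)
  then have c: "0 < c j" "n j \<in> \<int>" "n j + 1 \<le> u j" "j \<in> J - R" "T = c j * (n j + 1 - x j)"
    using j by (auto simp: pending_def)
  then have eq: "x j + T / c j = n j + 1"
    by simp
  have "ky j + c j = c j * (n j + 1 + 1 - x j)"
    using c(5) j(3) by (simp add: algebra_simps)
  moreover have "inv (md(j := 1)) (ky(j := next_key j (c j * (n j + 1 + 1 - x j)))) (n(j := n j + 1)) R T"
    by (rule inv_settle[OF inv j(1)]) (use eq c invD(7)[OF inv] in auto)
  ultimately show "inv (md(j := 1)) (ky(j := next_key j (ky j + c j))) (n(j := n j + 1)) R T"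
    by simp
  have "credit md n T j = n j"
    using j(2) by (simp add: credit_def)
  then show "slack (md(j := 1)) (n(j := n j + 1)) T \<le> sum a R"
    using sl[unfolded slack_inv_def, rule_format, OF c(4)] j(1)
    by (simp add: slack_upd[unfolded One_nat_def])
qed

text \<open>The removal takes \<open>a j\<close> off \<open>sum a R\<close>, but every variable now
  outside, \<open>j\<close> included, has a coefficient of at least \<open>a j\<close> to make up
  for it.\<close>

lemma slack_inv_move:
  assumes inv: "inv md ky n R T" and "slack md n T \<le> sum a R"
    and j: "j \<in> R" "\<And>k. k \<in> R \<Longrightarrow> a k \<le> a j"
  shows "slack_inv md n (R - {j}) T"
proof -
  have "finite R"
    using invD(2)[OF inv] finite_J finite_subset by blast
  then have "sum a (R - {j}) = sum a R - a j"
    using j by (simp add: sum_diff1)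
  moreover have "a j \<le> a i" if "i \<in> J - (R - {j})" for i
    using invD(7)[OF inv, of i j] j that by auto
  ultimately show ?thesis
    using assms(2) unfolding slack_inv_def by fastforce
qed

text \<open>\<open>credit\<close> rounds relaxed integer variables down anyway, so fixing
  \<open>j\<close> at its rounded value leaves the slack unchanged; only the line may drop.\<close>

lemma move_relaxed_step:
  assumes inv: "inv md ky n R T" and sl: "slack md n T \<le> sum a R"
    and j: "j \<in> R" "\<And>k. k \<in> R \<Longrightarrow> a k \<le> a j" "md j = 0"
  defines "v \<equiv> of_int \<lfloor>x j + T / c j\<rfloor>"
  shows "inv (md(j := 1)) (ky(j := next_key j (c j * (v + 1 - x j)))) (n(j := v)) (R - {j}) T"
    "slack_inv (md(j := 1)) (n(j := v)) (R - {j}) T"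
proof -
  have jJ: "j \<in> J" "j < d"
    using j(1) invD(2)[OF inv] J_sub by auto
  have c: "0 < c j" "ky j = c j * (u j - x j)"
    using invD(4)[OF inv jJ(2) j(3)] by auto
  then have le: "x j + T / c j \<le> u j"
    using invD(3)[OF inv jJ(2)] le_line_iff by auto
  show "inv (md(j := 1)) (ky(j := next_key j (c j * (v + 1 - x j)))) (n(j := v)) (R - {j}) T"
  proof (rule inv_settle[OF inv jJ(2) c(1)])
    show "v \<le> x j + T / c j" "x j + T / c j \<le> v + 1"
      unfolding v_def by linarith+
    then show "v \<le> u j"
      using le by simp
    show "a k \<le> a i" if "i \<in> J - (R - {j})" "k \<in> R - {j}" for i k
      using that j invD(7)[OF inv, of i k] by auto
  qed (use jJ in \<open>auto simp: v_def\<close>)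
  have "slack (md(j := 1)) (n(j := v)) T = slack md n T"
    using jJ j(3) by (simp add: slack_upd[unfolded One_nat_def] credit_def v_def)
  then show "slack_inv (md(j := 1)) (n(j := v)) (R - {j}) T"
    using slack_inv_move[OF inv sl j(1,2)] by (simp add: slack_inv_def)
qed

text \<open>Membership in \<open>R\<close> excludes \<open>pending\<close>, so \<open>j\<close> is
  saturated, and leaving \<open>R\<close> affects neither its key nor its credit.\<close>

lemma move_saturated_step:
  assumes inv: "inv md ky n R T" and sl: "slack md n T \<le> sum a R"
    and j: "j \<in> R" "\<And>k. k \<in> R \<Longrightarrow> a k \<le> a j" "md j \<noteq> 0"
  shows "inv md ky n (R - {j}) T" "slack_inv md n (R - {j}) T"
proof -
  have "a k \<le> a i" if "i \<in> J - (R - {j})" "k \<in> R - {j}" for i k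
    using that j invD(7)[OF inv, of i k] by auto
  then show "inv md ky n (R - {j}) T"
    using inv j unfolding inv_def by (auto simp: pending_def)
  show "slack_inv md n (R - {j}) T"
    by (rule slack_inv_move[OF inv sl j(1,2)])
qed

lemma finished:
  assumes "inv md ky n {} T" "slack md n T \<le> 0"
  shows "b \<le> total T" "0 \<le> T" "\<And>t. 0 \<le> t \<Longrightarrow> b \<le> total t \<Longrightarrow> T \<le> t"
  using assms credit_le_total[OF assms(1)] invD[OF assms(1)] by (auto simp: slack_def)

end


section \<open>Event simulation\<close>

abbreviation local_get :: "vname \<Rightarrow> rexp" where
  "local_get b \<equiv> RGet b (iscal ''j'')"

definition rekey :: com where
  "rekey =
     Seq (If (RLess (RMul (local_get ''lc'') (RSub (local_get ''lu'') (local_get ''lx''))) (rscal ''v''))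
           (RSet ''E'' (IAdd (iscal ''d'') (iscal ''j'')) (rscal ''big''))
           (RSet ''E'' (IAdd (iscal ''d'') (iscal ''j'')) (rscal ''v'')))
    (Seq (ISet ''mode'' (iscal ''j'') (IConst 1))
         (update_tree ''E''))"

definition settle :: com where
  "settle =
     Seq (rput ''al'' (RAdd (rscal ''al'') (RMul (local_get ''la'') (RSub (rscal ''n'') (local_get ''lx'')))))
    (Seq (rput ''rh'' (RSub (rscal ''rh'') (RDiv (local_get ''la'') (local_get ''lc''))))
    (Seq (rput ''v'' (RMul (local_get ''lc'') (RSub (RAdd (rscal ''n'') (RConst 1)) (local_get ''lx''))))
         rekey))"

definition move :: com where
  "move =
     If (RLess (RGet ''M'' (IConst 1)) (RConst 0))
       (Seq (iput ''j'' (IGet ''M'' (IConst 1)))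
       (Seq (RSet ''M'' (IAdd (iscal ''d'') (iscal ''j'')) (RConst 0))
       (Seq (update_tree ''M'')
            (If (ILess (IGet ''mode'' (iscal ''j'')) (IConst 1))
              (Seq (rput ''n'' (RFloor (RAdd (local_get ''lx'') (RDiv (rscal ''T'') (local_get ''lc'')))))
                   settle)
              Skip))))
       (iput ''run'' (IConst 0))"

text \<open>The counters \<open>n l\<close> are never stored: an integer event only shifts the
  offset by the coefficient of \<open>j\<close> and the key by its price, and a saturation needs
  only the upper bound.\<close>

definition iterate :: com where
  "iterate =
     Seq (iput ''j'' (IGet ''E'' (IConst 1)))
         (If (RLess (RAdd (rscal ''al'') (RMul (rscal ''rh'') (RGet ''E'' (IConst 1)))) (rscal ''b''))
           (Seq (rput ''T'' (RGet ''E'' (IConst 1)))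
                (If (ILess (IGet ''mode'' (iscal ''j'')) (IConst 1))
                  (Seq (rput ''n'' (local_get ''lu'')) settle)
                  (Seq (rput ''al'' (RAdd (rscal ''al'') (local_get ''la'')))
                  (Seq (rput ''v'' (RAdd (RGet ''E'' (IConst 1)) (local_get ''lc'')))
                  (Seq rekey move)))))
           (Seq (If (RLess (RAdd (rscal ''al'') (RMul (rscal ''rh'') (rscal ''T''))) (rscal ''b''))
                  (rput ''T'' (RDiv (RSub (rscal ''b'') (rscal ''al'')) (rscal ''rh'')))
                  Skip)
                move))"

definition running :: bexp where
  "running = ILess (IConst 0) (iscal ''run'')"

context row
begin

definition static :: "state \<Rightarrow> bool" where
  "static s \<longleftrightarrow> ix s ''d'' 0 = d \<and> re s ''b'' 0 = b \<and> re s ''big'' 0 = big \<and>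
     (\<forall>l<d. re s ''la'' l = a l \<and> re s ''lc'' l = c l \<and> re s ''lx'' l = x l \<and> re s ''lu'' l = u l)"

lemma static_cong:
  assumes "static s" "ix s' ''d'' = ix s ''d''"
    "\<forall>v\<in>{''b'', ''big'', ''la'', ''lc'', ''lx'', ''lu''}. re s' v = re s v"
  shows "static s'"
  using assms unfolding static_def by simp

text \<open>Coefficients are negated because the tournament keeps minima; since they are positive, a
  negative root of \<open>M\<close> signals that \<open>R\<close> is nonempty.\<close>

definition trees_ok :: "state \<Rightarrow> nat set \<Rightarrow> bool" where
  "trees_ok s R \<longleftrightarrow> tree_ok d (re s ''E'') (ix s ''E'') \<and> tree_ok d (re s ''M'') (ix s ''M'') \<and>
     (\<forall>l<d. re s ''M'' (d + l) = (if l \<in> R then - a l else 0))"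

definition key :: "state \<Rightarrow> nat \<Rightarrow> real" where
  "key s l = re s ''E'' (d + l)"

lemma inv_cong:
  assumes "inv md ky n R T" "\<And>l. l < d \<Longrightarrow> ky' l = ky l"
  shows "inv md ky' n R T"
  using assms unfolding inv_def saturated_def pending_def by auto

section \<open>Correctness and cost of one round\<close>

lemma wp_rekey:
  assumes st: "static s" and j: "ix s ''j'' 0 = j" "j < d" and lg: "2 * d \<le> 2 ^ lg"
    and E: "tree_ok d (re s ''E'') (ix s ''E'')"
    and Q: "\<And>s' t'. tree_ok d (re s' ''E'') (ix s' ''E'') \<Longrightarrow>
      \<forall>l<d. key s' l = ((key s)(j := next_key j (re s ''v'' 0))) l \<Longrightarrow>
      ix s' ''mode'' = (ix s ''mode'')(j := 1) \<Longrightarrow>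
      \<forall>b. b \<noteq> ''E'' \<longrightarrow> re s' b = re s b \<Longrightarrow>
      \<forall>b. b \<notin> {''E'', ''i'', ''mode''} \<longrightarrow> ix s' b = ix s b \<Longrightarrow> t' \<le> t + 60 * lg + 120 \<Longrightarrow> Q s' t'"
  shows "wp rekey Q s t"
proof -
  have "wp (If (RLess (RMul (local_get ''lc'') (RSub (local_get ''lu'') (local_get ''lx''))) (rscal ''v''))
           (RSet ''E'' (IAdd (iscal ''d'') (iscal ''j'')) (rscal ''big''))
           (RSet ''E'' (IAdd (iscal ''d'') (iscal ''j'')) (rscal ''v'')))
      (\<lambda>s1 t1. s1 = re_write ''E'' (d + j) (next_key j (re s ''v'' 0)) s \<and> t1 \<le> t + 30) s t"
    using st j by (simp add: static_def next_key_def)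
  then show ?thesis
    unfolding rekey_def wp_Seq
  proof (rule wp_mono, goal_cases)
    case (1 s1 t1)
    show ?case
      unfolding wp_ISet
    proof (rule wp_update_tree[where d = d and j = j and lg = lg and v = "re s ''E'' (d + j)"], goal_cases)
      case (8 s2 t2)
      show ?case
        by (rule Q) (use 8 1 j in \<open>auto simp: key_def\<close>)
    qed (use 1 st j lg E in \<open>auto simp: static_def\<close>)
  qed
qed

lemma wp_settle:
  assumes st: "static s" and j: "ix s ''j'' 0 = j" "j < d" and lg: "2 * d \<le> 2 ^ lg"
    and E: "tree_ok d (re s ''E'') (ix s ''E'')"
    and Q: "\<And>s' t'. tree_ok d (re s' ''E'') (ix s' ''E'') \<Longrightarrow>
      \<forall>l<d. key s' l = ((key s)(j := next_key j (c j * (re s ''n'' 0 + 1 - x j)))) l \<Longrightarrow>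
      ix s' ''mode'' = (ix s ''mode'')(j := 1) \<Longrightarrow>
      re s' ''al'' 0 = re s ''al'' 0 + a j * (re s ''n'' 0 - x j) \<Longrightarrow>
      re s' ''rh'' 0 = re s ''rh'' 0 - a j / c j \<Longrightarrow>
      \<forall>b. b \<notin> {''E'', ''al'', ''rh'', ''v''} \<longrightarrow> re s' b = re s b \<Longrightarrow>
      \<forall>b. b \<notin> {''E'', ''i'', ''mode''} \<longrightarrow> ix s' b = ix s b \<Longrightarrow> t' \<le> t + 60 * lg + 180 \<Longrightarrow> Q s' t'"
  shows "wp settle Q s t"
  unfolding settle_def wp_Seq wp_RSet
proof (rule wp_rekey[where j = j and lg = lg], goal_cases)
  case (6 s2 t2)
  show ?case
    by (rule Q) (use 6 st j in \<open>auto simp: static_def key_def\<close>)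
qed (use st j lg E in \<open>auto simp: static_def\<close>)

definition live :: "state \<Rightarrow> nat set \<Rightarrow> (nat \<Rightarrow> real) \<Rightarrow> bool" where
  "live s R n \<longleftrightarrow> static s \<and> trees_ok s R \<and> ix s ''run'' 0 = 1 \<and>
     re s ''al'' 0 = offset (ix s ''mode'') n \<and> re s ''rh'' 0 = rate (ix s ''mode'') \<and>
     inv (ix s ''mode'') (key s) n R (re s ''T'' 0)"

definition solved :: "state \<Rightarrow> bool" where
  "solved s \<longleftrightarrow> ix s ''run'' 0 = 0 \<and> 0 \<le> re s ''T'' 0 \<and> b \<le> total (re s ''T'' 0) \<and>
     (\<forall>t\<ge>0. b \<le> total t \<longrightarrow> re s ''T'' 0 \<le> t)"

text \<open>A saturation lowers the first count, a move the second; the \<open>1\<close> makes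
  halting, which has measure \<open>0\<close>, a decrease as well.\<close>

definition potential :: "state \<Rightarrow> nat set \<Rightarrow> nat" where
  "potential s R = card {l. l < d \<and> ix s ''mode'' l = 0} + card R + 1"

definition progress :: "nat \<Rightarrow> state \<Rightarrow> bool" where
  "progress m s \<longleftrightarrow> solved s \<and> m = 0 \<or>
     (\<exists>R n. live s R n \<and> slack_inv (ix s ''mode'') n R (re s ''T'' 0) \<and> m = potential s R)"

lemma mode_count_upd:
  "card {l. l < d \<and> (md(j := 1)) l = (0::nat)} \<le> card {l. l < d \<and> md l = 0}"
  "j < d \<Longrightarrow> md j = 0 \<Longrightarrow> card {l. l < d \<and> (md(j := 1)) l = (0::nat)} < card {l. l < d \<and> md l = 0}"
  by (auto intro!: card_mono psubset_card_mono)

lemma R_finite: "live s R n \<Longrightarrow> finite R"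
  unfolding live_def using invD(2) finite_J finite_subset by metis

lemma live_finished:
  assumes "live s {} n" "slack (ix s ''mode'') n (re s ''T'' 0) \<le> 0"
  shows "0 \<le> re s ''T'' 0 \<and> b \<le> total (re s ''T'' 0) \<and>
     (\<forall>t\<ge>0. b \<le> total t \<longrightarrow> re s ''T'' 0 \<le> t)"
  using assms finished unfolding live_def by metis

text \<open>With \<open>R\<close> empty the assumption on the slack says that \<open>T\<close>
  suffices, so the program may halt; otherwise the root of \<open>M\<close> names a variable of
  \<open>R\<close> with the largest coefficient.\<close>

lemma wp_move:
  assumes live: "live s R n" and d: "1 \<le> d" and lg: "2 * d \<le> 2 ^ lg"
    and sl: "slack (ix s ''mode'') n (re s ''T'' 0) \<le> sum a R"
    and Q: "\<And>s' t' m. progress m s' \<Longrightarrow> m < potential s R \<Longrightarrow> t' \<le> t + 120 * lg + 400 \<Longrightarrow> Q s' t'"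
  shows "wp move Q s t"
proof (cases "re s ''M'' 1 < 0")
  case True
  define j where "j = ix s ''M'' 1"
  from live have st: "static s" and tr: "trees_ok s R"
    and inv: "inv (ix s ''mode'') (key s) n R (re s ''T'' 0)"
    by (auto simp: live_def)
  have M: "tree_ok d (re s ''M'') (ix s ''M'')"
    and leaf: "\<And>l. l < d \<Longrightarrow> re s ''M'' (d + l) = (if l \<in> R then - a l else 0)"
    using tr by (auto simp: trees_ok_def)
  note root = tree_ok_root[OF M d, folded j_def]
  have jd: "j < d"
    by (rule root)
  have jR: "j \<in> R"
    using True root(2) leaf[OF jd] by (auto split: if_splits)
  have jmax: "a k \<le> a j" if "k \<in> R" for k
  proof -
    have "k < d"
      using that invD(2)[OF inv] J_sub by auto
    then show ?thesis
      using root(2) root(3)[of k] leaf[of k] leaf[OF jd] that jR by simp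
  qed
  have cR: "card (R - {j}) < card R"
    using jR R_finite[OF live] by (intro psubset_card_mono) auto
  let ?s = "re_write ''M'' (d + j) 0 (ix_write ''j'' 0 j s)"
  have "wp (update_tree ''M'')
     (\<lambda>s' t'. trees_ok s' (R - {j}) \<and> (\<forall>b. b \<noteq> ''M'' \<longrightarrow> re s' b = re s b) \<and>
        (\<forall>b. b \<notin> {''M'', ''i'', ''j''} \<longrightarrow> ix s' b = ix s b) \<and> ix s' ''j'' 0 = j \<and>
        t' \<le> t + 60 * lg + 120) ?s t2" if "t2 \<le> t + 20" for t2
  proof (rule wp_update_tree[where d = d and j = j and lg = lg and v = "re s ''M'' (d + j)"], goal_cases)
    case (8 s2 t2)
    then show ?case
      using tr leaf that by (auto simp: trees_ok_def)
  qed (use st d lg jd M in \<open>auto simp: static_def\<close>)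
  note upd = this
  have "wp (update_tree ''M'')
     (\<lambda>s t. wp (If (ILess (IGet ''mode'' (iscal ''j'')) (IConst 1))
              (Seq (rput ''n'' (RFloor (RAdd (local_get ''lx'') (RDiv (rscal ''T'') (local_get ''lc'')))))
                   settle)
              Skip) Q s t) ?s t2" if "t2 \<le> t + 20" for t2
    using upd[OF that]
  proof (rule wp_mono, goal_cases)
    case (1 s1 t1)
    then have st1: "static s1"
      by (intro static_cong[OF st]) auto
    have same: "ix s1 ''mode'' = ix s ''mode''" "key s1 = key s" "re s1 ''T'' = re s ''T''"
      "re s1 ''al'' = re s ''al''" "re s1 ''rh'' = re s ''rh''" "ix s1 ''run'' = ix s ''run''"
      "re s1 ''E'' = re s ''E''"
      using 1 by (auto simp: key_def fun_eq_iff)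
    show ?case
    proof (cases "ix s ''mode'' j = 0")
      case z: True
      define v where "v = real_of_int \<lfloor>x j + re s ''T'' 0 / c j\<rfloor>"
      have step: "inv ((ix s ''mode'')(j := 1)) ((key s)(j := next_key j (c j * (v + 1 - x j))))
          (n(j := v)) (R - {j}) (re s ''T'' 0)"
        "slack_inv ((ix s ''mode'')(j := 1)) (n(j := v)) (R - {j}) (re s ''T'' 0)"
        using move_relaxed_step[OF inv sl jR _ z] jmax unfolding v_def by blast+
      let ?s1 = "re_write ''n'' 0 v s1"
      have "wp settle Q ?s1 t2" if t2: "t2 \<le> t + 60 * lg + 200" for t2
      proof (rule wp_settle[where j = j and lg = lg], goal_cases)
        case (6 s2 t3)
        have eqs: "ix s2 ''mode'' = (ix s ''mode'')(j := 1)" "re s2 ''T'' 0 = re s ''T'' 0"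
          using 6 same by auto
        have k: "\<forall>l<d. key s2 l = ((key s)(j := next_key j (c j * (v + 1 - x j)))) l"
          using 6(2) same by (simp add: key_def)
        have tr2: "trees_ok s2 (R - {j})"
          using 6 1 by (simp add: trees_ok_def)
        have st2: "static s2"
          using 6 by (intro static_cong[OF st1]) auto
        have al: "re s2 ''al'' 0 = offset ((ix s ''mode'')(j := 1)) (n(j := v))"
          using live 6(4) same z by (simp add: offset_upd[OF jd, unfolded One_nat_def] live_def)
        have rh: "re s2 ''rh'' 0 = rate ((ix s ''mode'')(j := 1))"
          using live 6(5) same z by (simp add: rate_upd[OF jd, unfolded One_nat_def] live_def)
        have "inv (ix s2 ''mode'') (key s2) (n(j := v)) (R - {j}) (re s2 ''T'' 0)"
          unfolding eqs by (rule inv_cong[OF step(1)]) (rule k[rule_format])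
        moreover have "ix s2 ''run'' 0 = 1"
          using 6 same live by (simp add: live_def)
        ultimately have "live s2 (R - {j}) (n(j := v))"
          using st2 tr2 al rh eqs by (simp add: live_def)
        then have "progress (potential s2 (R - {j})) s2"
          using step(2) eqs unfolding progress_def by auto
        moreover have "potential s2 (R - {j}) < potential s R"
          using cR mode_count_upd(1)[of "ix s ''mode''" j] eqs by (simp add: potential_def)
        moreover have "t3 \<le> t + 120 * lg + 400"
          using 6 t2 by simp
        ultimately show ?case
          by (rule Q)
      qed (use 1 st1 jd lg tr in \<open>auto simp: static_def trees_ok_def\<close>)
      then show ?thesis
        using 1 st1 jd z by (simp add: static_def v_def)
    next
      case nz: False
      have step: "inv (ix s ''mode'') (key s) n (R - {j}) (re s ''T'' 0)"
        "slack_inv (ix s ''mode'') n (R - {j}) (re s ''T'' 0)"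
        using move_saturated_step[OF inv sl jR _ nz] jmax by blast+
      have "live s1 (R - {j}) n"
        using st1 1 live step same by (simp add: live_def)
      then have "progress (potential s1 (R - {j})) s1"
        using step(2) same unfolding progress_def by auto
      moreover have "potential s1 (R - {j}) < potential s R"
        using cR same by (simp add: potential_def)
      ultimately have "Q s1 t2" if "t2 \<le> t + 120 * lg + 400" for t2
        using Q that by blast
      then show ?thesis
        using 1 same nz by simp
    qed
  qed
  then show ?thesis
    unfolding move_def using True st by (simp add: static_def j_def[unfolded One_nat_def, symmetric])
next
  case False
  from live have tr: "trees_ok s R"
    and inv: "inv (ix s ''mode'') (key s) n R (re s ''T'' 0)"
    by (auto simp: live_def)
  have "R = {}"
  proof (rule ccontr)
    assume "R \<noteq> {}"
    then obtain l where "l \<in> R" by blast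
    then have "l < d"
      using invD(2)[OF inv] J_sub by auto
    then have "re s ''M'' 1 \<le> - a l"
      using tree_ok_root(3)[of d "re s ''M''" "ix s ''M''" l] tr d \<open>l \<in> R\<close> by (auto simp: trees_ok_def)
    then show False
      using False a_pos[OF \<open>l < d\<close>] by simp
  qed
  with live_finished[of s n] live sl have "progress 0 (ix_write ''run'' 0 0 s)"
    by (simp add: progress_def solved_def)
  then have "Q (ix_write ''run'' 0 0 s) t'" if "t' \<le> t + 120 * lg + 400" for t'
    by (rule Q) (use that in \<open>auto simp: potential_def\<close>)
  then show ?thesis
    unfolding move_def using False by simp
qed

text \<open>Every branch contains a saturation or a move. An integer event alone lowers neither
  count of \<open>potential\<close>, which is why a move follows it.\<close>

lemma wp_iterate:
  assumes pr: "progress m s" and run: "0 < ix s ''run'' 0" and d: "1 \<le> d" and lg: "2 * d \<le> 2 ^ lg"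
    and Q: "\<And>s' t' m'. progress m' s' \<Longrightarrow> m' < m \<Longrightarrow> t' \<le> t + 180 * lg + 700 \<Longrightarrow> Q s' t'"
  shows "wp iterate Q s t"
proof -
  from pr run obtain R n where live: "live s R n"
    and sl: "slack_inv (ix s ''mode'') n R (re s ''T'' 0)" and m: "m = potential s R"
    by (auto simp: progress_def solved_def)
  define j where "j = ix s ''E'' 1"
  define \<tau> where "\<tau> = re s ''E'' 1"
  from live have st: "static s" and tr: "trees_ok s R" and run1: "ix s ''run'' 0 = 1"
    and al: "re s ''al'' 0 = offset (ix s ''mode'') n" and rh: "re s ''rh'' 0 = rate (ix s ''mode'')"
    and inv: "inv (ix s ''mode'') (key s) n R (re s ''T'' 0)"
    by (auto simp: live_def)
  have E: "tree_ok d (re s ''E'') (ix s ''E'')"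
    using tr by (auto simp: trees_ok_def)
  note root = tree_ok_root[OF E d, folded j_def \<tau>_def]
  have jd: "j < d" and kj: "key s j = \<tau>" and \<tau>: "\<And>l. l < d \<Longrightarrow> \<tau> \<le> key s l"
    using root by (auto simp: key_def)
  have \<tau>in: "\<tau> \<in> key s ` {..<d}"
    using jd kj by auto
  show ?thesis
  proof (cases "offset (ix s ''mode'') n + rate (ix s ''mode'') * \<tau> < b")
    case True
    have adv: "inv (ix s ''mode'') (key s) n R \<tau>" "re s ''T'' 0 \<le> \<tau>"
      using advance_to_event[OF inv _ \<tau>in True] \<tau> by blast+
    \<comment> \<open>The bound survives the jump in time because credits only grow.\<close>
    have sl': "slack_inv (ix s ''mode'') n R \<tau>"
      using sl slack_antimono[OF adv(2)] unfolding slack_inv_def by (meson order_trans)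
    have nb: "\<tau> \<noteq> big"
      using event_not_big[OF inv _ True] \<tau> by blast
    let ?s = "re_write ''T'' 0 \<tau> (ix_write ''j'' 0 j s)"
    show ?thesis
    proof (cases "ix s ''mode'' j = 0")
      case z: True
      note step = saturate_step[OF adv(1) jd z kj[symmetric] sl']
      have "wp settle Q (re_write ''n'' 0 (u j) ?s) t2" if t2: "t2 \<le> t + 100" for t2
      proof (rule wp_settle[where j = j and lg = lg], goal_cases)
        case (6 s2 t3)
        have eqs: "ix s2 ''mode'' = (ix s ''mode'')(j := 1)" "re s2 ''T'' 0 = \<tau>"
          using 6 by auto
        have k: "\<forall>l<d. key s2 l = ((key s)(j := next_key j (c j * (u j + 1 - x j)))) l"
          using 6(2) by (simp add: key_def)
        have tr2: "trees_ok s2 R"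
          using 6 tr by (simp add: trees_ok_def)
        have st2: "static s2"
          using 6 by (intro static_cong[OF st]) auto
        have al2: "re s2 ''al'' 0 = offset ((ix s ''mode'')(j := 1)) (n(j := u j))"
          using al 6(4) z by (simp add: offset_upd[OF jd, unfolded One_nat_def])
        have rh2: "re s2 ''rh'' 0 = rate ((ix s ''mode'')(j := 1))"
          using rh 6(5) z by (simp add: rate_upd[OF jd, unfolded One_nat_def])
        have "inv (ix s2 ''mode'') (key s2) (n(j := u j)) R (re s2 ''T'' 0)"
          unfolding eqs by (rule inv_cong[OF step(1)]) (rule k[rule_format])
        moreover have "ix s2 ''run'' 0 = 1"
          using 6 run1 by simp
        ultimately have "live s2 R (n(j := u j))"
          using st2 tr2 al2 rh2 eqs by (simp add: live_def)
        then have "progress (potential s2 R) s2"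
          using step(2) eqs unfolding progress_def by auto
        moreover have "potential s2 R < m"
          using mode_count_upd(2)[OF jd, of "ix s ''mode''"] z eqs m by (simp add: potential_def)
        moreover have "t3 \<le> t + 180 * lg + 700"
          using 6 t2 by simp
        ultimately show ?case
          by (rule Q)
      qed (use st jd lg E in \<open>auto simp: static_def\<close>)
      then show ?thesis
        unfolding iterate_def using True st jd z al rh by (simp add: static_def j_def[unfolded One_nat_def, symmetric] \<tau>_def[unfolded One_nat_def, symmetric])
    next
      case nz: False
      note step = increment_step[OF adv(1) jd nz kj[symmetric] _ sl', unfolded kj, OF nb]
      let ?s1 = "re_write ''v'' 0 (\<tau> + c j) (re_write ''al'' 0 (offset (ix s ''mode'') n + a j) ?s)"
      have "wp rekey (\<lambda>s t. wp move Q s t) ?s1 t2" if t2: "t2 \<le> t + 120" for t2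
      proof (rule wp_rekey[where j = j and lg = lg], goal_cases)
        case (6 s2 t3)
        have eqs: "ix s2 ''mode'' = (ix s ''mode'')(j := 1)" "re s2 ''T'' 0 = \<tau>"
          using 6 by auto
        have k: "\<forall>l<d. key s2 l = ((key s)(j := next_key j (\<tau> + c j))) l"
          using 6(2) by (simp add: key_def)
        have tr2: "trees_ok s2 R"
          using 6 tr by (simp add: trees_ok_def)
        have st2: "static s2"
          using 6 by (intro static_cong[OF st]) auto
        have al2: "re s2 ''al'' 0 = offset ((ix s ''mode'')(j := 1)) (n(j := n j + 1))"
          using 6(4) nz by (simp add: offset_upd[OF jd, unfolded One_nat_def])
        have rh2: "re s2 ''rh'' 0 = rate ((ix s ''mode'')(j := 1))"
          using rh 6(4) nz by (simp add: rate_upd[OF jd, unfolded One_nat_def])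
        have "inv (ix s2 ''mode'') (key s2) (n(j := n j + 1)) R (re s2 ''T'' 0)"
          unfolding eqs by (rule inv_cong[OF step(1)]) (rule k[rule_format])
        moreover have "ix s2 ''run'' 0 = 1"
          using 6 run1 by simp
        ultimately have live2: "live s2 R (n(j := n j + 1))"
          using st2 tr2 al2 rh2 eqs by (simp add: live_def)
        have pot: "potential s2 R \<le> m"
          using mode_count_upd(1)[of "ix s ''mode''" j] eqs m by (simp add: potential_def)
        show ?case
          by (rule wp_move[OF live2 d lg]) (use step(2) eqs pot 6 t2 in \<open>auto intro!: Q\<close>)
      qed (use st jd lg E in \<open>auto simp: static_def\<close>)
      then show ?thesis
        unfolding iterate_def using True st jd nz al rh by (simp add: static_def j_def[unfolded One_nat_def, symmetric] \<tau>_def[unfolded One_nat_def, symmetric])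
    qed
  next
    case False
    define T' where "T' = (if offset (ix s ''mode'') n + rate (ix s ''mode'') * re s ''T'' 0 < b
      then (b - offset (ix s ''mode'') n) / rate (ix s ''mode'') else re s ''T'' 0)"
    have ge: "b \<le> offset (ix s ''mode'') n + rate (ix s ''mode'') * \<tau>"
      using False by simp
    have adv: "inv (ix s ''mode'') (key s) n R T'" "slack (ix s ''mode'') n T' \<le> sum a R"
      using advance_relaxed[OF inv _ \<tau>in ge T'_def] \<tau> by blast+
    have "wp (If (RLess (RAdd (rscal ''al'') (RMul (rscal ''rh'') (rscal ''T''))) (rscal ''b''))
                  (rput ''T'' (RDiv (RSub (rscal ''b'') (rscal ''al'')) (rscal ''rh'')))
                  Skip)
       (\<lambda>s' t'. re s' ''T'' 0 = T' \<and> (\<forall>b. b \<noteq> ''T'' \<longrightarrow> re s' b = re s b) \<and>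
          (\<forall>b. b \<noteq> ''j'' \<longrightarrow> ix s' b = ix s b) \<and> t' \<le> t + 100) (ix_write ''j'' 0 j s) t2"
      if "t2 \<le> t + 50" for t2
      using that al rh st by (simp add: T'_def static_def)
    then have "wp (If (RLess (RAdd (rscal ''al'') (RMul (rscal ''rh'') (rscal ''T''))) (rscal ''b''))
                  (rput ''T'' (RDiv (RSub (rscal ''b'') (rscal ''al'')) (rscal ''rh'')))
                  Skip)
       (\<lambda>s t. wp move Q s t) (ix_write ''j'' 0 j s) t2" if "t2 \<le> t + 50" for t2
    proof (rule wp_mono, goal_cases)
      case (2 s1 t1)
      have st1: "static s1"
        using 2 by (intro static_cong[OF st]) auto
      have same: "key s1 = key s"
        using 2 by (auto simp: key_def fun_eq_iff)
      have live1: "live s1 R n"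
        using st1 2 live adv same by (simp add: live_def trees_ok_def)
      have pot: "potential s1 R = m"
        using 2 m by (simp add: potential_def)
      show ?case
        by (rule wp_move[OF live1 d lg]) (use adv(2) pot 2 in \<open>auto intro!: Q\<close>)
    qed (rule that)
    note w = this
    have g: "\<not> bval (RLess (RAdd (rscal ''al'') (RMul (rscal ''rh'') (RGet ''E'' (IConst 1)))) (rscal ''b''))
        (ix_write ''j'' 0 j s)"
      using False st al rh by (simp add: static_def \<tau>_def)
    have eq: "ix_write ''j'' (ival (IConst 0) s) (ival (IGet ''E'' (IConst 1)) s) s = ix_write ''j'' 0 j s"
      by (simp add: j_def)
    show ?thesis
      unfolding iterate_def wp_Seq wp_ISet eq
      by (subst wp_If) (simp only: g if_False wp_Seq, rule w, simp)
  qed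
qed

lemma wp_search:
  assumes pr: "progress m s" and d: "1 \<le> d" and lg: "2 * d \<le> 2 ^ lg"
    and Q: "\<And>s' t'. solved s' \<Longrightarrow> t' \<le> t + m * (180 * lg + 710) + 10 \<Longrightarrow> Q s' t'"
  shows "wp (While running iterate) Q s t"
proof (rule wp_While[where n = m and
    I = "\<lambda>k s' t'. progress k s' \<and> t' + k * (180 * lg + 710) \<le> t + m * (180 * lg + 710)"])
  fix k s1 t1
  assume I: "progress k s1 \<and> t1 + k * (180 * lg + 710) \<le> t + m * (180 * lg + 710)"
    and g: "bval running s1"
  show "wp iterate (\<lambda>s' t'. \<exists>k'<k. progress k' s' \<and> t' + k' * (180 * lg + 710) \<le> t + m * (180 * lg + 710))
    s1 (t1 + (1 + btime running))"
  proof (rule wp_iterate[OF conjunct1[OF I] _ d lg], goal_cases)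
    case (2 s2 t2 k')
    then have "(k' + 1) * (180 * lg + 710) \<le> k * (180 * lg + 710)"
      by (intro mult_le_mono) auto
    then have "t2 + k' * (180 * lg + 710) \<le> t + m * (180 * lg + 710)"
      using 2 I by (simp add: running_def)
    then show ?case
      using 2 by blast
  qed (use g in \<open>simp add: running_def\<close>)
next
  fix k s1 t1
  assume I: "progress k s1 \<and> t1 + k * (180 * lg + 710) \<le> t + m * (180 * lg + 710)"
    and g: "\<not> bval running s1"
  then have "solved s1"
    by (auto simp: progress_def live_def running_def)
  then show "Q s1 (t1 + (1 + btime running))"
    by (rule Q) (use I in \<open>simp add: running_def\<close>)
qed (use pr in simp)

end


section \<open>Cost of the greedy algorithm\<close>

lemma cap_floor_mono: "x j \<le> y j \<Longrightarrow> cap_floor P x j \<le> cap_floor P y j"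
  by (auto simp: cap_floor_def min_def intro: floor_mono order_trans)

lemma cap_floor_le: "cap_floor P x j \<le> x j"
  unfolding cap_floor_def by (auto intro: order_trans[OF of_int_floor_le])

lemma finite_vars: "finite (vars P i)"
  by (simp add: vars_def)

lemma row_constraint_iff:
  assumes "wf_cmip P"
  shows "x \<in> row_constraint P i \<longleftrightarrow>
     (\<forall>j<nvars P. 0 \<le> x j) \<and> rhs P i \<le> (\<Sum>j\<in>vars P i. mat P i j * cap_floor P x j)"
proof -
  have sub: "ints P \<subseteq> {..<nvars P}"
    using assms by (simp add: wf_cmip_def)
  have "(\<Sum>j\<in>vars P i. mat P i j * cap_floor P x j) = (\<Sum>j<nvars P. mat P i j * cap_floor P x j)"
    by (rule sum.mono_neutral_left) (auto simp: vars_def)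
  also have "\<dots> = (\<Sum>j\<in>{..<nvars P} - ints P. mat P i j * cap_floor P x j) +
      (\<Sum>j\<in>ints P. mat P i j * cap_floor P x j)"
    by (rule sum.subset_diff[OF sub]) simp
  also have "\<dots> = (\<Sum>j\<in>ints P. mat P i j * of_int \<lfloor>min (x j) (ub P j)\<rfloor>) +
         (\<Sum>j\<in>{..<nvars P} - ints P. mat P i j * min (x j) (ub P j))"
    by (simp add: cap_floor_def)
  finally show ?thesis
    unfolding row_constraint_def by simp
qed

lemma mat_nonneg: "wf_cmip P \<Longrightarrow> i < nrows P \<Longrightarrow> j \<in> vars P i \<Longrightarrow> 0 \<le> mat P i j"
  by (simp add: wf_cmip_def vars_def)

text \<open>The reason a single pass over the rows suffices: later steps only raise \<open>x\<close>
  and never break a row that holds.\<close>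

lemma row_constraint_mono:
  assumes "wf_cmip P" "i < nrows P" "x \<in> row_constraint P i" "\<And>j. j < nvars P \<Longrightarrow> x j \<le> y j"
  shows "y \<in> row_constraint P i"
proof -
  have "(\<Sum>j\<in>vars P i. mat P i j * cap_floor P x j) \<le> (\<Sum>j\<in>vars P i. mat P i j * cap_floor P y j)"
    using assms by (intro sum_mono mult_left_mono cap_floor_mono mat_nonneg) (auto simp: vars_def)
  moreover have "\<forall>j<nvars P. 0 \<le> y j"
    using assms unfolding row_constraint_iff[OF assms(1)] by (meson order_trans)
  ultimately show ?thesis
    using assms(3) unfolding row_constraint_iff[OF assms(1)] by auto
qed

lemma cap_floor_feasible:
  assumes "z \<in> cmip_feasible P" "j < nvars P"
  shows "cap_floor P z j = z j"
proof -
  have "z j \<le> ub P j" "j \<in> ints P \<Longrightarrow> z j \<in> \<int>"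
    using assms by (auto simp: cmip_feasible_def)
  then show ?thesis
    by (auto simp: cap_floor_def min_absorb1 elim: Ints_cases)
qed

lemma feasible_row_constraint:
  assumes "wf_cmip P" "z \<in> cmip_feasible P" "i < nrows P"
  shows "z \<in> row_constraint P i"
proof -
  have "(\<Sum>j\<in>vars P i. mat P i j * cap_floor P z j) = (\<Sum>j<nvars P. mat P i j * z j)"
    using cap_floor_feasible[OF assms(2)]
    by (intro sum.mono_neutral_cong_left) (auto simp: vars_def)
  then show ?thesis
    using assms unfolding row_constraint_iff[OF assms(1)] by (simp add: cmip_feasible_def)
qed

section \<open>Charging greedy steps to a feasible point\<close>

lemma greedy_step_ge:
  assumes "wf_cmip P" "0 \<le> \<beta>"
  shows "x j \<le> greedy_step P i \<beta> x j"
proof -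
  have "0 \<le> \<beta> / price P j" if "j \<in> vars P i"
    using assms that by (auto simp: wf_cmip_def vars_def)
  then show ?thesis
    by (simp add: greedy_step_def)
qed

lemma greedy_reaches_nonneg:
  assumes "wf_cmip P" "greedy_reaches P x"
  shows "0 \<le> x j"
  using assms(2)
proof (induction)
  case (step x i \<beta>)
  then show ?case
    using greedy_step_ge[OF assms(1) step.hyps(4), of x j i] by linarith
qed simp

lemma sum_diff_vars:
  fixes f g :: "nat \<Rightarrow> real"
  assumes "\<And>j. j \<notin> vars P i \<Longrightarrow> f j = g j"
  shows "sum f {..<nvars P} - sum g {..<nvars P} = (\<Sum>j\<in>vars P i. f j - g j)"
  unfolding sum_subtractf[symmetric]
  by (rule sum.mono_neutral_right) (auto simp: vars_def intro: assms[unfolded vars_def])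

text \<open>Potential of the cost analysis: a step of size \<open>\<beta>\<close> lowers it by at least \<open>\<beta>\<close> and raises the
  cost by at most \<open>\<beta>\<close> per variable of the row.\<close>

definition gap :: "cmip \<Rightarrow> (nat \<Rightarrow> real) \<Rightarrow> (nat \<Rightarrow> real) \<Rightarrow> real" where
  "gap P z x = (\<Sum>j<nvars P. price P j * max (z j - x j) 0)"

text \<open>Either one variable of the row is still at least \<open>\<beta>\<close> in cost away
  from \<open>z\<close> and absorbs the whole step, or the step closes the gap on every variable of
  the row with positive price, and that part of the gap was at least \<open>\<beta>\<close>.\<close>

lemma gap_step:
  assumes wf: "wf_cmip P" and z: "z \<in> cmip_feasible P" and i: "i < nrows P"
    and x0: "\<And>j. 0 \<le> x j" and \<beta>: "0 \<le> \<beta>"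
    and inf: "ereal \<beta> \<le> (INF y\<in>{y \<in> row_constraint P i. \<forall>j<nvars P. x j \<le> y j}.
                          ereal (cost P y - cost P x))"
  shows "\<beta> \<le> gap P z x - gap P z (greedy_step P i \<beta> x)"
proof -
  have c: "0 \<le> price P j" if "j \<in> vars P i" for j
    using wf that by (auto simp: wf_cmip_def vars_def)
  let ?x' = "greedy_step P i \<beta> x"
  let ?\<delta> = "\<lambda>j. price P j * max (z j - x j) 0 - price P j * max (z j - ?x' j) 0"
  \<comment> \<open>Raising \<open>x\<close> to \<open>z\<close> on the variables of row
    \<open>i\<close> alone satisfies the row, so the infimum bounds \<open>\<beta>\<close> by the
    part of the gap that belongs to the row.\<close>
  define y where "y j = (if j \<in> vars P i then max (x j) (z j) else x j)" for j
  have "rhs P i \<le> (\<Sum>j\<in>vars P i. mat P i j * cap_floor P z j)"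
    using feasible_row_constraint[OF wf z i] row_constraint_iff[OF wf] by blast
  also have "\<dots> \<le> (\<Sum>j\<in>vars P i. mat P i j * cap_floor P y j)"
    by (intro sum_mono mult_left_mono cap_floor_mono mat_nonneg[OF wf i]) (auto simp: y_def)
  finally have "y \<in> row_constraint P i"
    unfolding row_constraint_iff[OF wf] using x0 by (auto simp: y_def le_max_iff_disj)
  moreover have "\<forall>j<nvars P. x j \<le> y j"
    by (simp add: y_def)
  ultimately have "ereal \<beta> \<le> ereal (cost P y - cost P x)"
    using inf by (intro order_trans[OF inf] INF_lower) auto
  also have "cost P y - cost P x = (\<Sum>j\<in>vars P i. price P j * y j - price P j * x j)"
    unfolding cost_def by (rule sum_diff_vars) (simp add: y_def)
  also have "\<dots> = (\<Sum>j\<in>vars P i. price P j * max (z j - x j) 0)"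
    by (intro sum.cong) (auto simp: y_def max_def algebra_simps)
  finally have \<beta>_le: "\<beta> \<le> (\<Sum>j\<in>vars P i. price P j * max (z j - x j) 0)"
    by simp
  have nonneg: "0 \<le> ?\<delta> j" if "j \<in> vars P i" for j
  proof -
    have "price P j * max (z j - ?x' j) 0 \<le> price P j * max (z j - x j) 0"
      using c[OF that] greedy_step_ge[OF wf \<beta>, of x j i] by (intro mult_left_mono) auto
    then show ?thesis by simp
  qed
  have "\<beta> \<le> (\<Sum>j\<in>vars P i. ?\<delta> j)"
  proof (cases "\<exists>j\<in>vars P i. 0 < price P j \<and> \<beta> \<le> price P j * (z j - x j)")
    case True
    then obtain j where j: "j \<in> vars P i" "0 < price P j" "\<beta> \<le> price P j * (z j - x j)"
      by blast
    then have "\<beta> / price P j \<le> z j - x j"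
      by (simp add: pos_divide_le_eq mult.commute)
    moreover have "0 \<le> \<beta> / price P j"
      using j \<beta> by simp
    ultimately have "max (z j - x j) 0 = z j - x j" "max (z j - ?x' j) 0 = z j - x j - \<beta> / price P j"
      using j by (auto simp: greedy_step_def max_def)
    then have "?\<delta> j = price P j * (z j - x j) - price P j * (z j - x j - \<beta> / price P j)"
      by simp
    also have "\<dots> = \<beta>"
      using j by (simp add: right_diff_distrib)
    finally have "?\<delta> j = \<beta>" .
    then show ?thesis
      using member_le_sum[of j "vars P i" ?\<delta>] j nonneg finite_vars by force
  next
    case False
    have "?\<delta> j = price P j * max (z j - x j) 0" if j: "j \<in> vars P i" for j
    proof (cases "price P j = 0")
      case p: False
      then have "price P j * (z j - x j) < \<beta>" "0 < price P j"
        using False j c[OF j] by force+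
      then have "z j - x j < \<beta> / price P j"
        by (simp add: pos_less_divide_eq mult.commute)
      then show ?thesis
        using p j by (simp add: greedy_step_def)
    qed simp
    then have "(\<Sum>j\<in>vars P i. ?\<delta> j) = (\<Sum>j\<in>vars P i. price P j * max (z j - x j) 0)"
      by (intro sum.cong refl)
    then show ?thesis
      using \<beta>_le by linarith
  qed
  moreover have "gap P z x - gap P z ?x' = (\<Sum>j\<in>vars P i. ?\<delta> j)"
    unfolding gap_def by (rule sum_diff_vars) (simp add: greedy_step_def)
  ultimately show ?thesis
    by simp
qed

lemma card_vars_le: "i < nrows P \<Longrightarrow> card (vars P i) \<le> max_row_nnz P"
  unfolding max_row_nnz_def by (intro Max_ge) auto

text \<open>A variable of positive price costs exactly \<open>\<beta>\<close>; one of price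
  \<open>0\<close> costs nothing however far it is raised.\<close>

lemma cost_step:
  assumes "i < nrows P" "0 \<le> \<beta>"
  shows "cost P (greedy_step P i \<beta> x) - cost P x \<le> real (max_row_nnz P) * \<beta>"
proof -
  have "cost P (greedy_step P i \<beta> x) - cost P x =
      (\<Sum>j\<in>vars P i. price P j * greedy_step P i \<beta> x j - price P j * x j)"
    unfolding cost_def by (rule sum_diff_vars) (simp add: greedy_step_def)
  also have "\<dots> \<le> (\<Sum>j\<in>vars P i. \<beta>)"
    using assms by (intro sum_mono) (auto simp: greedy_step_def algebra_simps)
  also have "\<dots> \<le> real (max_row_nnz P) * \<beta>"
    using card_vars_le[OF assms(1)] assms(2) by (simp add: mult_right_mono)
  finally show ?thesis .
qed

text \<open>At the origin the gap is all of \<open>cost P z\<close>, so the parenthesis is the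
  amount by which the gap has dropped so far.\<close>

lemma greedy_reaches_cost:
  assumes wf: "wf_cmip P" and z: "z \<in> cmip_feasible P" and "greedy_reaches P x"
  shows "cost P x \<le> real (max_row_nnz P) * (cost P z - gap P z x)"
  using assms(3)
proof (induction)
  case start
  have "gap P z (\<lambda>_. 0) = cost P z"
    using z unfolding gap_def cost_def by (intro sum.cong) (auto simp: cmip_feasible_def)
  then show ?case
    by (simp add: cost_def)
next
  case (step x i \<beta>)
  have "\<beta> \<le> gap P z x - gap P z (greedy_step P i \<beta> x)"
    using step greedy_reaches_nonneg[OF wf] by (intro gap_step[OF wf z]) auto
  then have "real (max_row_nnz P) * \<beta> \<le> real (max_row_nnz P) * (gap P z x - gap P z (greedy_step P i \<beta> x))"
    by (intro mult_left_mono) auto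
  with step.IH cost_step[OF step.hyps(2,4), of x] show ?case
    by (simp add: algebra_simps)
qed

lemma greedy_final_approx:
  assumes wf: "wf_cmip P" and ne: "cmip_feasible P \<noteq> {}" and fin: "greedy_final P x"
    and sol: "\<And>j. j < nvars P \<Longrightarrow> sol j = cap_floor P x j"
  shows "approx_solution P (real (max_row_nnz P)) sol"
proof -
  have reach: "greedy_reaches P x" and rows: "\<And>i. i < nrows P \<Longrightarrow> x \<in> row_constraint P i"
    using fin by (auto simp: greedy_final_def)
  note x0 = greedy_reaches_nonneg[OF wf reach]
  have ub0: "0 \<le> ub P j" "0 \<le> price P j" if "j < nvars P" for j
    using wf that by (auto simp: wf_cmip_def)
  have ints: "ints P \<subseteq> {..<nvars P}"
    using wf by (simp add: wf_cmip_def)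
  have "0 \<le> sol j" "sol j \<le> ub P j" if "j < nvars P" for j
    using sol[OF that] ub0[OF that] x0[of j]
    by (auto simp: cap_floor_def min_def intro: order_trans[OF of_int_floor_le])
  moreover have "rhs P i \<le> (\<Sum>j<nvars P. mat P i j * sol j)" if "i < nrows P" for i
  proof -
    have "rhs P i \<le> (\<Sum>j\<in>vars P i. mat P i j * cap_floor P x j)"
      using rows[OF that] row_constraint_iff[OF wf] by blast
    also have "\<dots> = (\<Sum>j<nvars P. mat P i j * sol j)"
      using sol by (intro sum.mono_neutral_cong_left) (auto simp: vars_def)
    finally show ?thesis .
  qed
  moreover have "sol j \<in> \<int>" if "j \<in> ints P" for j
    using sol[of j] ints that by (auto simp: cap_floor_def)
  ultimately have feas: "sol \<in> cmip_feasible P"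
    by (simp add: cmip_feasible_def)
  have "cost P sol \<le> cost P x"
    unfolding cost_def using sol ub0 cap_floor_le by (intro sum_mono mult_left_mono) auto
  moreover have "cost P x \<le> real (max_row_nnz P) * cost P z" if z: "z \<in> cmip_feasible P" for z
  proof -
    have "0 \<le> gap P z x"
      unfolding gap_def using ub0 by (intro sum_nonneg) auto
    then have "real (max_row_nnz P) * (cost P z - gap P z x) \<le> real (max_row_nnz P) * cost P z"
      by (intro mult_left_mono) auto
    with greedy_reaches_cost[OF wf z reach] show ?thesis
      by simp
  qed
  ultimately have le: "cost P sol \<le> real (max_row_nnz P) * cost P z" if "z \<in> cmip_feasible P" for z
    using that by (meson order_trans)
  have "cost P sol \<le> real (max_row_nnz P) * cmip_opt P"
  \<comment> \<open>The bound for each single \<open>z\<close> passes to the infimum after division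
    by the ratio, which must be nonzero for this.\<close>
  proof (cases "max_row_nnz P = 0")
    case True
    then show ?thesis
      using le ne by auto
  next
    case False
    then have "cost P sol / real (max_row_nnz P) \<le> cmip_opt P"
      unfolding cmip_opt_def using le ne by (intro cINF_greatest) (auto simp: field_simps)
    then show ?thesis
      using False by (simp add: field_simps)
  qed
  with feas show ?thesis
    by (simp add: approx_solution_def)
qed

text \<open>A point \<open>y \<ge> x\<close> that costs \<open>t\<close> more than \<open>x\<close> exceeds \<open>x j\<close> by at most \<open>t / price P j\<close>, so up to
  capping it lies below the point that the step of size \<open>t\<close> leads to.\<close>

lemma step_size_le_INF:
  assumes wf: "wf_cmip P" and i: "i < nrows P" and x0: "\<And>j. 0 \<le> x j"
    and T: "\<And>t. 0 \<le> t \<Longrightarrow> greedy_step P i t x \<in> row_constraint P i \<Longrightarrow> T \<le> t"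
  shows "ereal T \<le> (INF y\<in>{y \<in> row_constraint P i. \<forall>j<nvars P. x j \<le> y j}.
                          ereal (cost P y - cost P x))"
proof (rule INF_greatest)
  fix y assume "y \<in> {y \<in> row_constraint P i. \<forall>j<nvars P. x j \<le> y j}"
  then have y: "y \<in> row_constraint P i" and ge: "\<And>j. j < nvars P \<Longrightarrow> x j \<le> y j"
    by auto
  have c: "0 \<le> price P j" if "j < nvars P" for j
    using wf that by (auto simp: wf_cmip_def)
  define t where "t = cost P y - cost P x"
  have t: "t = (\<Sum>j<nvars P. price P j * (y j - x j))"
    by (simp add: t_def cost_def sum_subtractf right_diff_distrib)
  have t_ge: "price P j * (y j - x j) \<le> t" if "j < nvars P" for j
    unfolding t using c ge that by (intro member_le_sum) auto
  have t0: "0 \<le> t"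
    unfolding t using c ge by (intro sum_nonneg) auto
  have "cap_floor P y j \<le> cap_floor P (greedy_step P i t x) j" if j: "j \<in> vars P i" for j
  proof (cases "price P j = 0")
    case True
    then have "min (y j) (ub P j) \<le> min (greedy_step P i t x j) (ub P j)"
      using j by (simp add: greedy_step_def)
    then show ?thesis
      by (simp add: cap_floor_def floor_mono)
  next
    case False
    then have "y j \<le> greedy_step P i t x j"
      using j c[of j] t_ge[of j] by (simp add: vars_def greedy_step_def field_simps)
    then show ?thesis
      by (rule cap_floor_mono)
  qed
  then have "(\<Sum>j\<in>vars P i. mat P i j * cap_floor P y j) \<le>
      (\<Sum>j\<in>vars P i. mat P i j * cap_floor P (greedy_step P i t x) j)"
    by (intro sum_mono mult_left_mono mat_nonneg[OF wf i])
  moreover have "0 \<le> greedy_step P i t x j" for j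
    using greedy_step_ge[OF wf t0, of x j i] x0[of j] by simp
  ultimately have "greedy_step P i t x \<in> row_constraint P i"
    using y unfolding row_constraint_iff[OF wf] by fastforce
  then show "ereal T \<le> ereal (cost P y - cost P x)"
    using T[OF t0] by (simp add: t_def)
qed


section \<open>The program\<close>

abbreviation entry :: "vname \<Rightarrow> iexp" where
  "entry l \<equiv> IAdd (iscal ''p'') (iscal l)"

abbreviation column :: "vname \<Rightarrow> iexp" where
  "column l \<equiv> IGet ''col'' (entry l)"

text \<open>Memory layout: the entries of the current row are \<open>p, \<dots>, p + d - 1\<close>, with local copies of their
  data in \<open>la, lc, lx, lu\<close>; \<open>E\<close> is the tournament of event times, \<open>M\<close> the one of the negated
  coefficients of the integer variables that are still relaxed (0 for all others).\<close>

definition in_row :: bexp where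
  "in_row = BAnd (ILess (entry ''d'') (iscal ''nnz''))
     (BNot (ILess (IGet ''row'' (iscal ''p'')) (IGet ''row'' (entry ''d''))))"

definition scan_body :: com where
  "scan_body =
     Seq (rput ''L'' (RAdd (rscal ''L'') (RMul (RGet ''val'' (entry ''d'')) (RGet ''sol'' (column ''d'')))))
    (Seq (rput ''big'' (RAdd (rscal ''big'') (RMul (RGet ''price'' (column ''d'')) (RGet ''ub'' (column ''d'')))))
         (iput ''d'' (IAdd (iscal ''d'') (IConst 1))))"

definition scan :: com where
  "scan =
     Seq (iput ''d'' (IConst 0))
    (Seq (rput ''L'' (RConst 0))
    (Seq (rput ''big'' (RConst 1))
         (While in_row scan_body)))"

definition in_segment :: bexp where
  "in_segment = ILess (iscal ''l'') (iscal ''d'')"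

definition next_entry :: com where
  "next_entry = iput ''l'' (IAdd (iscal ''l'') (IConst 1))"

abbreviation leaf :: iexp where
  "leaf \<equiv> IAdd (iscal ''d'') (iscal ''l'')"

definition fill_copy :: com where
  "fill_copy =
     Seq (RSet ''la'' (iscal ''l'') (RGet ''val'' (entry ''l'')))
    (Seq (RSet ''lc'' (iscal ''l'') (RGet ''price'' (column ''l'')))
    (Seq (RSet ''lx'' (iscal ''l'') (RGet ''x'' (column ''l'')))
    (Seq (ISet ''M'' leaf (iscal ''l''))
    (Seq (ISet ''E'' leaf (iscal ''l''))
         (If (ILess (IConst 0) (IGet ''int'' (column ''l'')))
           (Seq (RSet ''lu'' (iscal ''l'') (RFloor (RGet ''ub'' (column ''l''))))
                (RSet ''M'' leaf (RSub (RConst 0) (RGet ''val'' (entry ''l'')))))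
           (Seq (RSet ''lu'' (iscal ''l'') (RGet ''ub'' (column ''l'')))
                (RSet ''M'' leaf (RConst 0))))))))"

abbreviation here :: "vname \<Rightarrow> rexp" where
  "here b \<equiv> RGet b (iscal ''l'')"

definition fill_event :: com where
  "fill_event =
     If (BAnd (RLess (RConst 0) (here ''lc'')) (RLess (here ''lx'') (here ''lu'')))
       (Seq (ISet ''mode'' (iscal ''l'') (IConst 0))
       (Seq (rput ''al'' (RAdd (rscal ''al'') (RMul (here ''la'') (here ''lx''))))
       (Seq (rput ''rh'' (RAdd (rscal ''rh'') (RDiv (here ''la'') (here ''lc''))))
            (RSet ''E'' leaf (RMul (here ''lc'') (RSub (here ''lu'') (here ''lx'')))))))
       (Seq (ISet ''mode'' (iscal ''l'') (IConst 1))
       (Seq (rput ''al'' (RAdd (rscal ''al'') (RMul (here ''la'') (here ''lu''))))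
            (RSet ''E'' leaf (rscal ''big''))))"

definition fill :: com where
  "fill =
     Seq (iput ''l'' (IConst 0))
    (Seq (iput ''run'' (IConst 1))
    (Seq (rput ''al'' (RConst 0))
    (Seq (rput ''rh'' (RConst 0))
    (Seq (rput ''T'' (RConst 0))
    (Seq (rput ''b'' (RGet ''rhs'' (IGet ''row'' (iscal ''p''))))
         (While in_segment (Seq fill_copy (Seq fill_event next_entry))))))))"

definition raise_entry :: com where
  "raise_entry =
     If (RLess (RConst 0) (RGet ''price'' (column ''l'')))
       (RSet ''x'' (column ''l'') (RAdd (RGet ''x'' (column ''l'')) (RDiv (rscal ''T'') (RGet ''price'' (column ''l'')))))
       (If (RLess (RGet ''x'' (column ''l'')) (RGet ''ub'' (column ''l'')))
         (RSet ''x'' (column ''l'') (RGet ''ub'' (column ''l'')))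
         Skip)"

definition round_entry :: com where
  "round_entry =
     Seq (If (RLess (RGet ''x'' (column ''l'')) (RGet ''ub'' (column ''l'')))
           (RSet ''sol'' (column ''l'') (RGet ''x'' (column ''l'')))
           (RSet ''sol'' (column ''l'') (RGet ''ub'' (column ''l''))))
         (If (ILess (IConst 0) (IGet ''int'' (column ''l'')))
           (RSet ''sol'' (column ''l'') (RFloor (RGet ''sol'' (column ''l''))))
           Skip)"

definition apply_step :: com where
  "apply_step =
     Seq (iput ''l'' (IConst 0))
         (While in_segment (Seq raise_entry (Seq round_entry next_entry)))"

definition repair :: com where
  "repair = Seq fill (Seq (build_tree ''E'') (Seq (build_tree ''M'')
     (Seq (While running iterate) apply_step)))"

definition solve_row :: com where
  "solve_row =
     Seq scan
    (Seq (If (RLess (rscal ''L'') (RGet ''rhs'' (IGet ''row'' (iscal ''p'')))) repair Skip)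
         (iput ''p'' (entry ''d'')))"

definition unprocessed :: bexp where
  "unprocessed = ILess (iscal ''p'') (iscal ''nnz'')"

definition greedy_prog :: com where
  "greedy_prog = While unprocessed solve_row"

locale inst =
  fixes P :: cmip and es :: "(nat \<times> nat) list"
  assumes wf: "wf_cmip P" and feasible: "cmip_feasible P \<noteq> {}" and sparse: "sparse_rows P es"
begin

definition inputs :: "state \<Rightarrow> bool" where
  "inputs s \<longleftrightarrow> ix s ''nnz'' 0 = length es \<and>
     (\<forall>k<length es. ix s ''row'' k = fst (es ! k) \<and> ix s ''col'' k = snd (es ! k) \<and>
        re s ''val'' k = mat P (fst (es ! k)) (snd (es ! k))) \<and>
     (\<forall>j<nvars P. (0 < ix s ''int'' j \<longleftrightarrow> j \<in> ints P) \<and>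
        re s ''price'' j = price P j \<and> re s ''ub'' j = ub P j) \<and>
     (\<forall>i<nrows P. re s ''rhs'' i = rhs P i)"

lemma inputs_cong:
  assumes "inputs s" "\<forall>v\<in>{''nnz'', ''row'', ''col'', ''int''}. ix s' v = ix s v"
    "\<forall>v\<in>{''val'', ''price'', ''ub'', ''rhs''}. re s' v = re s v"
  shows "inputs s'"
  using assms unfolding inputs_def by simp

lemma inputs_init: "inputs (input_state P es)"
  by (simp add: inputs_def input_state_def)

lemma entry_bounds:
  assumes "k < length es"
  shows "fst (es ! k) < nrows P" "snd (es ! k) \<in> vars P (fst (es ! k))" "snd (es ! k) < nvars P"
proof -
  have "es ! k \<in> {(i, j). i < nrows P \<and> j \<in> vars P i}"
    using nth_mem[OF assms] sparse unfolding sparse_rows_def by simp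
  then show "fst (es ! k) < nrows P" "snd (es ! k) \<in> vars P (fst (es ! k))" "snd (es ! k) < nvars P"
    by (auto simp: vars_def)
qed

lemma rows_sorted: "k \<le> k' \<Longrightarrow> k' < length es \<Longrightarrow> fst (es ! k) \<le> fst (es ! k')"
  using sparse sorted_nth_mono[of "map fst es" k k'] unfolding sparse_rows_def by simp

lemma wp_scan:
  assumes inp: "inputs s" and p: "ix s ''p'' 0 = p" "p < length es"
    and before: "\<And>k. k < p \<Longrightarrow> fst (es ! k) < fst (es ! p)"
    and Q: "\<And>s' t' d. 1 \<le> d \<Longrightarrow> p + d \<le> length es \<Longrightarrow>
      \<forall>k<length es. fst (es ! k) = fst (es ! p) \<longleftrightarrow> p \<le> k \<and> k < p + d \<Longrightarrow>
      ix s' ''d'' 0 = d \<Longrightarrow>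
      re s' ''L'' 0 = (\<Sum>l<d. mat P (fst (es ! p)) (snd (es ! (p + l))) * re s ''sol'' (snd (es ! (p + l)))) \<Longrightarrow>
      re s' ''big'' 0 = 1 + (\<Sum>l<d. price P (snd (es ! (p + l))) * ub P (snd (es ! (p + l)))) \<Longrightarrow>
      \<forall>v. v \<noteq> ''d'' \<longrightarrow> ix s' v = ix s v \<Longrightarrow>
      \<forall>v. v \<notin> {''L'', ''big''} \<longrightarrow> re s' v = re s v \<Longrightarrow> t' \<le> t + 100 * d + 100 \<Longrightarrow> Q s' t'"
  shows "wp scan Q s t"
proof -
  define J where "J d s' t' \<longleftrightarrow> p + d \<le> length es \<and>
      (\<forall>l<d. fst (es ! (p + l)) = fst (es ! p)) \<and> ix s' ''d'' 0 = d \<and>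
      re s' ''L'' 0 = (\<Sum>l<d. mat P (fst (es ! p)) (snd (es ! (p + l))) * re s ''sol'' (snd (es ! (p + l)))) \<and>
      re s' ''big'' 0 = 1 + (\<Sum>l<d. price P (snd (es ! (p + l))) * ub P (snd (es ! (p + l)))) \<and>
      (\<forall>v. v \<noteq> ''d'' \<longrightarrow> ix s' v = ix s v) \<and>
      (\<forall>v. v \<notin> {''L'', ''big''} \<longrightarrow> re s' v = re s v) \<and> t' \<le> t + 100 * d + 50" for d :: nat and s' :: state and t' :: nat
  let ?I = "\<lambda>n s' t'. \<exists>d. n = length es - d \<and> J d s' t'"
  show ?thesis
    unfolding scan_def wp_Seq wp_ISet wp_RSet
  proof (rule wp_While[where I = ?I and n = "length es"])
    fix n s1 t1
    assume "?I n s1 t1" and g: "bval in_row s1"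
    then obtain d where n: "n = length es - d" and "J d s1 t1"
      by blast
    then have I: "p + d \<le> length es"
      "\<forall>l<d. fst (es ! (p + l)) = fst (es ! p)" "ix s1 ''d'' 0 = d"
      "re s1 ''L'' 0 = (\<Sum>l<d. mat P (fst (es ! p)) (snd (es ! (p + l))) * re s ''sol'' (snd (es ! (p + l))))"
      "re s1 ''big'' 0 = 1 + (\<Sum>l<d. price P (snd (es ! (p + l))) * ub P (snd (es ! (p + l))))"
      "\<forall>v. v \<noteq> ''d'' \<longrightarrow> ix s1 v = ix s v"
      "\<forall>v. v \<notin> {''L'', ''big''} \<longrightarrow> re s1 v = re s v" "t1 \<le> t + 100 * d + 50"
      by (auto simp: J_def)
    have pd: "p + d < length es" and same: "\<not> fst (es ! p) < fst (es ! (p + d))"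
      using g I inp p by (auto simp: in_row_def inputs_def)
    \<comment> \<open>The guard excludes only a larger row index; sortedness excludes a smaller
      one.\<close>
    then have eq: "fst (es ! (p + d)) = fst (es ! p)"
      using rows_sorted[of p "p + d"] by simp
    have "\<forall>l<Suc d. fst (es ! (p + l)) = fst (es ! p)"
      using I(2) eq by (auto simp: less_Suc_eq)
    then have step: "wp scan_body (J (Suc d)) s1 (t1 + (1 + btime in_row))"
      unfolding scan_body_def J_def using I inp p pd eq entry_bounds[OF pd]
      by (simp add: inputs_def in_row_def)
    have "length es - Suc d < n"
      using n pd by simp
    then show "wp scan_body (\<lambda>s' t'. \<exists>n'<n. ?I n' s' t') s1 (t1 + (1 + btime in_row))"
      by (intro wp_mono[OF step]) blast
  next
    fix n s1 t1
    assume "?I n s1 t1" and g: "\<not> bval in_row s1"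
    then obtain d where n: "n = length es - d" and "J d s1 t1"
      by blast
    then have I: "p + d \<le> length es"
      "\<forall>l<d. fst (es ! (p + l)) = fst (es ! p)" "ix s1 ''d'' 0 = d"
      "re s1 ''L'' 0 = (\<Sum>l<d. mat P (fst (es ! p)) (snd (es ! (p + l))) * re s ''sol'' (snd (es ! (p + l))))"
      "re s1 ''big'' 0 = 1 + (\<Sum>l<d. price P (snd (es ! (p + l))) * ub P (snd (es ! (p + l))))"
      "\<forall>v. v \<noteq> ''d'' \<longrightarrow> ix s1 v = ix s v"
      "\<forall>v. v \<notin> {''L'', ''big''} \<longrightarrow> re s1 v = re s v" "t1 \<le> t + 100 * d + 50"
      by (auto simp: J_def)
    have stop: "p + d < length es \<Longrightarrow> fst (es ! p) < fst (es ! (p + d))"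
      using g I inp p by (auto simp: in_row_def inputs_def)
    \<comment> \<open>Entry \<open>p\<close> belongs to its own row, so the loop cannot stop at
      \<open>d = 0\<close>.\<close>
    have d1: "1 \<le> d"
      using stop p by (cases d) auto
    have seg: "fst (es ! k) = fst (es ! p) \<longleftrightarrow> p \<le> k \<and> k < p + d" if "k < length es" for k
    proof -
      consider "k < p" | "p \<le> k" "k < p + d" | "p + d \<le> k"
        by linarith
      then show ?thesis
      proof cases
        case 1
        then show ?thesis
          using before[of k] by simp
      next
        case 2
        then show ?thesis
          using I(2)[rule_format, of "k - p"] by simp
      next
        case 3
        then show ?thesis
          using stop rows_sorted[of "p + d" k] that by simp
      qed
    qed
    show "Q s1 (t1 + (1 + btime in_row))"
      by (rule Q[of d]) (use I d1 seg in \<open>auto simp: in_row_def\<close>)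
  qed (use p in \<open>auto simp: J_def intro!: exI[of _ "0::nat"]\<close>)
qed

end

section \<open>A block of entries as an instance of \<open>row\<close>\<close>

locale segment = inst +
  fixes p d :: nat and X :: "nat \<Rightarrow> real"
  assumes p_less: "p < length es" and d1: "1 \<le> d" and pd: "p + d \<le> length es"
    and seg: "\<And>k. k < length es \<Longrightarrow> fst (es ! k) = fst (es ! p) \<longleftrightarrow> p \<le> k \<and> k < p + d"
    and X0: "\<And>j. 0 \<le> X j"
begin

definition r :: nat where "r = fst (es ! p)"
definition col :: "nat \<Rightarrow> nat" where "col l = snd (es ! (p + l))"
definition coef :: "nat \<Rightarrow> real" where "coef l = mat P r (col l)"
definition cst :: "nat \<Rightarrow> real" where "cst l = price P (col l)"
definition cur :: "nat \<Rightarrow> real" where "cur l = X (col l)"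
definition cap :: "nat \<Rightarrow> real" where
  "cap l = (if col l \<in> ints P then of_int \<lfloor>ub P (col l)\<rfloor> else ub P (col l))"
definition ivars :: "nat set" where "ivars = {l. l < d \<and> col l \<in> ints P}"
text \<open>A bound on all event times that one scan can compute: current values are non-negative,
  so no variable needs more than its price times its upper bound, and the \<open>1\<close> makes the
  bound strict.\<close>

definition huge :: real where "huge = 1 + (\<Sum>l<d. price P (col l) * ub P (col l))"

lemma r_less: "r < nrows P"
  using entry_bounds(1)[OF p_less] by (simp add: r_def)

lemma entry_eq: "l < d \<Longrightarrow> es ! (p + l) = (r, col l)"
  using seg[of "p + l"] pd unfolding r_def col_def by (simp add: prod_eq_iff)

lemma col_vars: "l < d \<Longrightarrow> col l \<in> vars P r"
  using entry_bounds(2)[of "p + l"] entry_eq[of l] pd by auto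

lemma col_less: "l < d \<Longrightarrow> col l < nvars P"
  using col_vars by (simp add: vars_def)

lemma col_inj:
  assumes "l < d" "l' < d"
  shows "col l = col l' \<longleftrightarrow> l = l'"
proof
  assume "col l = col l'"
  then have "es ! (p + l) = es ! (p + l')"
    using entry_eq assms by simp
  moreover have "distinct es"
    using sparse by (simp add: sparse_rows_def)
  ultimately show "l = l'"
    using assms pd by (simp add: nth_eq_iff_index_eq)
qed simp

lemma col_image: "col ` {..<d} = vars P r"
proof
  show "vars P r \<subseteq> col ` {..<d}"
  proof
    fix j assume "j \<in> vars P r"
    then have "(r, j) \<in> set es"
      using sparse r_less unfolding sparse_rows_def by simp
    then obtain k where k: "k < length es" "es ! k = (r, j)"
      by (auto simp: in_set_conv_nth)
    then have "p \<le> k" "k < p + d"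
      using seg[of k] by (auto simp: r_def)
    then have "j = col (k - p)" "k - p < d"
      using k by (auto simp: col_def)
    then show "j \<in> col ` {..<d}"
      by blast
  qed
qed (use col_vars in auto)

lemma sum_vars: "(\<Sum>j\<in>vars P r. f j) = (\<Sum>l<d. f (col l))"
  unfolding col_image[symmetric] by (subst sum.reindex) (auto simp: inj_on_def col_inj)

lemma data_nonneg:
  assumes "l < d"
  shows "0 < coef l" "0 \<le> cst l" "0 \<le> ub P (col l)"
proof -
  have "0 \<le> coef l" "coef l \<noteq> 0"
    using mat_nonneg[OF wf r_less col_vars[OF assms]] col_vars[OF assms]
    by (simp_all add: coef_def vars_def)
  then show "0 < coef l"
    by simp
  show "0 \<le> cst l" "0 \<le> ub P (col l)"
    using wf col_less[OF assms] by (simp_all add: wf_cmip_def cst_def)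
qed

lemma cap_le: "cap l \<le> ub P (col l)"
  by (simp add: cap_def)

lemma huge_gt:
  assumes "l < d"
  shows "cst l * (cap l - cur l) < huge"
proof -
  have "cst l * (cap l - cur l) \<le> price P (col l) * ub P (col l)"
    unfolding cst_def using cap_le[of l] X0 data_nonneg[OF assms]
    by (intro mult_left_mono) (auto simp: cur_def cst_def add_increasing2 diff_le_eq)
  also have "\<dots> \<le> (\<Sum>l<d. price P (col l) * ub P (col l))"
    using assms data_nonneg by (intro member_le_sum) (auto simp: cst_def)
  finally show ?thesis
    by (simp add: huge_def)
qed

text \<open>The capped upper bounds dominate every feasible point; the existence of one is used
  here.\<close>

lemma need_coverable: "rhs P r \<le> (\<Sum>l<d. coef l * cap l)"
proof -
  obtain z where z: "z \<in> cmip_feasible P"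
    using feasible by blast
  have "rhs P r \<le> (\<Sum>j\<in>vars P r. mat P r j * cap_floor P z j)"
    using feasible_row_constraint[OF wf z r_less] row_constraint_iff[OF wf] by blast
  also have "\<dots> = (\<Sum>l<d. coef l * cap_floor P z (col l))"
    by (simp add: sum_vars coef_def)
  also have "\<dots> \<le> (\<Sum>l<d. coef l * cap l)"
    using data_nonneg
    by (intro sum_mono mult_left_mono) (simp_all add: cap_floor_def cap_def less_imp_le floor_mono)
  finally show ?thesis .
qed

sublocale row d coef cst cur cap ivars "rhs P r" huge
proof
  show "0 \<le> huge"
    using data_nonneg by (auto simp: huge_def cst_def intro!: add_nonneg_nonneg sum_nonneg)
qed (use data_nonneg huge_gt need_coverable in \<open>auto simp: ivars_def cap_def\<close>)

text \<open>Capping by the upper bound and capping by its integer part agree after rounding down, so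
  \<open>level\<close> may work with the integral bound.\<close>

lemma cap_floor_step:
  assumes "l < d"
  shows "cap_floor P (greedy_step P r t X) (col l) =
    (if l \<in> ivars then of_int \<lfloor>level l t\<rfloor> else level l t)"
proof -
  have "min (greedy_step P r t X (col l)) (ub P (col l)) =
      (if cst l = 0 then ub P (col l) else min (cur l + t / cst l) (ub P (col l)))"
    using col_vars[OF assms] by (simp add: greedy_step_def cst_def cur_def)
  moreover have "\<lfloor>min y v\<rfloor> = min \<lfloor>y\<rfloor> \<lfloor>v\<rfloor>" for y v :: real
    by (rule min_of_mono[symmetric]) (simp add: monoI floor_mono)
  then have "\<lfloor>min y (ub P (col l))\<rfloor> = \<lfloor>min y (of_int \<lfloor>ub P (col l)\<rfloor>)\<rfloor>" for y
    by simp
  ultimately show ?thesis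
    using assms by (simp add: cap_floor_def level_def cap_def ivars_def)
qed

text \<open>Identifies the least time found by the event simulation with the least sufficient greedy
  step size.\<close>

lemma total_iff:
  assumes "0 \<le> t"
  shows "rhs P r \<le> total t \<longleftrightarrow> greedy_step P r t X \<in> row_constraint P r"
proof -
  have "0 \<le> greedy_step P r t X j" for j
    using greedy_step_ge[OF wf assms, of X j r] X0[of j] by simp
  moreover have "(\<Sum>j\<in>vars P r. mat P r j * cap_floor P (greedy_step P r t X) j) = total t"
    unfolding sum_vars total_def by (intro sum.cong) (auto simp: cap_floor_step coef_def)
  ultimately show ?thesis
    unfolding row_constraint_iff[OF wf] by simp
qed

section \<open>Loading a row into the local arrays\<close>

lemma input_entries:
  assumes "inputs s" "l < d"
  shows "ix s ''row'' p = r" "ix s ''col'' (p + l) = col l" "re s ''val'' (p + l) = coef l"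
    "0 < ix s ''int'' (col l) \<longleftrightarrow> l \<in> ivars" "0 < ix s ''int'' (col l) \<longleftrightarrow> col l \<in> ints P"
    "re s ''price'' (col l) = cst l"
    "re s ''ub'' (col l) = ub P (col l)" "re s ''rhs'' r = rhs P r"
  using assms pd p_less r_less col_less[OF assms(2)] entry_eq[OF assms(2)]
  by (auto simp: inputs_def coef_def cst_def ivars_def r_def)

text \<open>A variable that is free or already at its cap starts out saturated; all others start
  relaxed, integer ones included.\<close>

definition slot :: "state \<Rightarrow> nat \<Rightarrow> bool" where
  "slot s l \<longleftrightarrow> re s ''la'' l = coef l \<and> re s ''lc'' l = cst l \<and> re s ''lx'' l = cur l \<and>
      re s ''lu'' l = cap l \<and> ix s ''M'' (d + l) = l \<and> ix s ''E'' (d + l) = l \<and>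
      re s ''M'' (d + l) = (if l \<in> ivars then - coef l else 0) \<and>
      ix s ''mode'' l = (if 0 < cst l \<and> cur l < cap l then 0 else 1) \<and>
      re s ''E'' (d + l) = (if 0 < cst l \<and> cur l < cap l then cst l * (cap l - cur l) else huge)"

definition filled :: "state \<Rightarrow> nat \<Rightarrow> bool" where
  "filled s k \<longleftrightarrow> (\<forall>l<k. slot s l) \<and>
    re s ''al'' 0 = (\<Sum>l<k. if 0 < cst l \<and> cur l < cap l then coef l * cur l else coef l * cap l) \<and>
    re s ''rh'' 0 = (\<Sum>l<k. if 0 < cst l \<and> cur l < cap l then coef l / cst l else 0)"

lemma wp_fill_copy:
  assumes inp: "inputs s" and st: "ix s ''p'' 0 = p" "ix s ''d'' 0 = d" "ix s ''l'' 0 = l" "l < d"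
      "re s ''x'' = X"
    and Q: "\<And>s' t'. re s' ''la'' = (re s ''la'')(l := coef l) \<Longrightarrow> re s' ''lc'' = (re s ''lc'')(l := cst l) \<Longrightarrow>
      re s' ''lx'' = (re s ''lx'')(l := cur l) \<Longrightarrow> re s' ''lu'' = (re s ''lu'')(l := cap l) \<Longrightarrow>
      ix s' ''M'' = (ix s ''M'')(d + l := l) \<Longrightarrow> ix s' ''E'' = (ix s ''E'')(d + l := l) \<Longrightarrow>
      re s' ''M'' = (re s ''M'')(d + l := if l \<in> ivars then - coef l else 0) \<Longrightarrow>
      \<forall>v. v \<notin> {''M'', ''E''} \<longrightarrow> ix s' v = ix s v \<Longrightarrow>
      \<forall>v. v \<notin> {''la'', ''lc'', ''lx'', ''lu'', ''M''} \<longrightarrow> re s' v = re s v \<Longrightarrow>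
      t' \<le> t + 150 \<Longrightarrow> Q s' t'"
  shows "wp fill_copy Q s t"
proof (cases "col l \<in> ints P")
  case True
  then have "l \<in> ivars"
    using st by (simp add: ivars_def)
  then show ?thesis
    unfolding fill_copy_def using st True input_entries[OF inp st(4)]
    by (simp add: cur_def cap_def, intro Q) (auto simp: cur_def cap_def)
next
  case False
  then have "l \<notin> ivars"
    using st by (simp add: ivars_def)
  then show ?thesis
    unfolding fill_copy_def using st False input_entries[OF inp st(4)]
    by (simp add: cur_def cap_def, intro Q) (auto simp: cur_def cap_def)
qed

lemma wp_fill_event:
  assumes st: "ix s ''d'' 0 = d" "ix s ''l'' 0 = l" "re s ''la'' l = coef l" "re s ''lc'' l = cst l"
      "re s ''lx'' l = cur l" "re s ''lu'' l = cap l" "re s ''big'' 0 = huge"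
    and Q: "\<And>s' t'. ix s' ''mode'' = (ix s ''mode'')(l := if 0 < cst l \<and> cur l < cap l then 0 else 1) \<Longrightarrow>
      re s' ''E'' = (re s ''E'')(d + l := if 0 < cst l \<and> cur l < cap l then cst l * (cap l - cur l) else huge) \<Longrightarrow>
      re s' ''al'' 0 = re s ''al'' 0 + (if 0 < cst l \<and> cur l < cap l then coef l * cur l else coef l * cap l) \<Longrightarrow>
      re s' ''rh'' 0 = re s ''rh'' 0 + (if 0 < cst l \<and> cur l < cap l then coef l / cst l else 0) \<Longrightarrow>
      \<forall>v. v \<noteq> ''mode'' \<longrightarrow> ix s' v = ix s v \<Longrightarrow>
      \<forall>v. v \<notin> {''E'', ''al'', ''rh''} \<longrightarrow> re s' v = re s v \<Longrightarrow> t' \<le> t + 150 \<Longrightarrow> Q s' t'"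
  shows "wp fill_event Q s t"
  unfolding fill_event_def using st
  by (cases "0 < cst l"; cases "cur l < cap l"; simp; intro Q; simp)

lemma wp_fill:
  assumes inp: "inputs s" and st: "ix s ''p'' 0 = p" "ix s ''d'' 0 = d" "re s ''x'' = X"
      "re s ''big'' 0 = huge"
    and Q: "\<And>s' t'. filled s' d \<Longrightarrow> ix s' ''run'' 0 = 1 \<Longrightarrow> re s' ''T'' 0 = 0 \<Longrightarrow>
      re s' ''b'' 0 = rhs P r \<Longrightarrow> t' \<le> t + 400 * d + 100 \<Longrightarrow> Q s' t'"
  shows "wp fill Q s t"
proof -
  define keep where "keep s' \<longleftrightarrow> inputs s' \<and> ix s' ''p'' 0 = p \<and> ix s' ''d'' 0 = d \<and> re s' ''x'' = X \<and>
    re s' ''big'' 0 = huge \<and> ix s' ''run'' 0 = 1 \<and> re s' ''T'' 0 = 0 \<and> re s' ''b'' 0 = rhs P r" for s' :: state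
  let ?I = "\<lambda>n s' t'. \<exists>l\<le>d. n = d - l \<and> ix s' ''l'' 0 = l \<and> keep s' \<and> filled s' l \<and>
    t' \<le> t + 400 * l + 60"
  have loop: "wp (While in_segment (Seq fill_copy (Seq fill_event next_entry))) Q s0 t0"
    if "keep s0" "ix s0 ''l'' 0 = 0" "filled s0 0" "t0 \<le> t + 60" for s0 t0
  proof (rule wp_While[where I = ?I and n = d])
    fix n s1 t1
    assume "?I n s1 t1" and g: "bval in_segment s1"
    then obtain l where I: "n = d - l" "ix s1 ''l'' 0 = l" "keep s1" "filled s1 l"
      "t1 \<le> t + 400 * l + 60"
      by blast
    have ld: "l < d"
      using g I by (simp add: in_segment_def keep_def)
    show "wp (Seq fill_copy (Seq fill_event next_entry)) (\<lambda>s' t'. \<exists>n'<n. ?I n' s' t')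
      s1 (t1 + (1 + btime in_segment))"
      unfolding wp_Seq
    proof (rule wp_fill_copy[where l = l], goal_cases)
      case (7 s2 t2)
      show ?case
      proof (rule wp_fill_event[where l = l], goal_cases)
        case (8 s3 t3)
        have "inputs s3"
          by (rule inputs_cong[of s1]) (use I(3) 7 8 in \<open>simp_all add: keep_def\<close>)
        then have "keep s3"
          using I(3) 7 8 unfolding keep_def by simp
        then have keep: "keep (ix_write ''l'' 0 (Suc l) s3)"
          unfolding keep_def using inputs_cong[of s3 "ix_write ''l'' 0 (Suc l) s3"] by simp
        have "slot s3 k" if "k < Suc l" for k
        proof (cases "k = l")
          case True
          then show ?thesis
            unfolding slot_def using 7 8 by simp
        next
          case False
          then have "slot s1 k"
            using I(4) that by (simp add: filled_def)
          then show ?thesis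
            unfolding slot_def using 7 8 False by simp
        qed
        then have "filled s3 (Suc l)"
          using I(4) 7 8 unfolding filled_def by simp
        then have "filled (ix_write ''l'' 0 (Suc l) s3) (Suc l)"
          by (simp add: filled_def slot_def)
        with keep have "?I (d - Suc l) (ix_write ''l'' 0 (Suc l) s3) (t3 + 6)"
          using I(5) ld 7(10) 8(7) by (intro exI[of _ "Suc l"]) (simp add: in_segment_def)
        moreover have "d - Suc l < n"
          using I(1) ld by simp
        moreover have "ix s3 ''l'' 0 = l"
          using I(2) 7 8 by simp
        ultimately show ?case
          unfolding next_entry_def wp_ISet by (intro exI[of _ "d - Suc l"]) simp
      qed (use I 7 in \<open>simp_all add: keep_def\<close>)
    qed (use I ld in \<open>simp_all add: keep_def\<close>)
  next
    fix n s1 t1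
    assume "?I n s1 t1" and g: "\<not> bval in_segment s1"
    then obtain l where I: "l \<le> d" "ix s1 ''l'' 0 = l" "keep s1" "filled s1 l"
      "t1 \<le> t + 400 * l + 60"
      by blast
    then have "l = d"
      using g by (simp add: in_segment_def keep_def)
    then show "Q s1 (t1 + (1 + btime in_segment))"
      using I by (intro Q) (auto simp: keep_def in_segment_def)
  next
    show "?I d s0 t0"
      using that by (intro exI[of _ 0]) simp
  qed
  show ?thesis
    unfolding fill_def using inp st input_entries[OF inp, of 0] d1
    by (simp, intro loop) (simp_all add: keep_def filled_def inputs_cong[OF inp])
qed

end

section \<open>Applying the step, and the initial state of the search\<close>

context segment
begin

lemma wp_raise_entry:
  assumes inp: "inputs s" and st: "ix s ''p'' 0 = p" "ix s ''l'' 0 = l" "l < d" "re s ''T'' 0 = T"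
      "re s ''x'' (col l) = X (col l)"
    and Q: "\<And>s' t'. re s' ''x'' = (re s ''x'')(col l := greedy_step P r T X (col l)) \<Longrightarrow> ix s' = ix s \<Longrightarrow>
      \<forall>v. v \<noteq> ''x'' \<longrightarrow> re s' v = re s v \<Longrightarrow> t' \<le> t + 60 \<Longrightarrow> Q s' t'"
  shows "wp raise_entry Q s t"
proof -
  note e = input_entries[OF inp st(3)] and v = col_vars[OF st(3)]
  consider "0 < cst l" | "cst l = 0" "X (col l) < ub P (col l)" | "cst l = 0" "ub P (col l) \<le> X (col l)"
    using data_nonneg(2)[OF st(3)] by linarith
  then show ?thesis
  proof cases
    case 1
    then have "greedy_step P r T X (col l) = X (col l) + T / cst l"
      using v by (simp add: greedy_step_def cst_def)
    then show ?thesis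
      unfolding raise_entry_def using st e 1 by (simp, intro Q) simp_all
  next
    case 2
    then have "greedy_step P r T X (col l) = ub P (col l)"
      using v by (simp add: greedy_step_def cst_def)
    then show ?thesis
      unfolding raise_entry_def using st e 2 by (simp, intro Q) simp_all
  next
    case 3
    then have "greedy_step P r T X (col l) = X (col l)"
      using v by (simp add: greedy_step_def cst_def)
    then have "(re s ''x'')(col l := greedy_step P r T X (col l)) = re s ''x''"
      using st by (simp add: fun_upd_idem)
    then show ?thesis
      unfolding raise_entry_def using st e 3 by (simp, intro Q) simp_all
  qed
qed

lemma wp_round_entry:
  assumes inp: "inputs s" and st: "ix s ''p'' 0 = p" "ix s ''l'' 0 = l" "l < d"
    and Q: "\<And>s' t'. re s' ''sol'' = (re s ''sol'')(col l := cap_floor P (re s ''x'') (col l)) \<Longrightarrow> ix s' = ix s \<Longrightarrow>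
      \<forall>v. v \<noteq> ''sol'' \<longrightarrow> re s' v = re s v \<Longrightarrow> t' \<le> t + 80 \<Longrightarrow> Q s' t'"
  shows "wp round_entry Q s t"
  unfolding round_entry_def using st input_entries[OF inp st(3)]
  by (cases "re s ''x'' (col l) < ub P (col l)"; cases "col l \<in> ints P"; simp; intro Q)
    (simp_all add: cap_floor_def min_def)

lemma wp_apply_step:
  assumes inp: "inputs s" and st: "ix s ''p'' 0 = p" "ix s ''d'' 0 = d" "re s ''x'' = X" "re s ''T'' 0 = T"
    and Q: "\<And>s' t'. re s' ''x'' = greedy_step P r T X \<Longrightarrow>
      re s' ''sol'' = (\<lambda>j. if j \<in> vars P r then cap_floor P (greedy_step P r T X) j else re s ''sol'' j) \<Longrightarrow>
      t' \<le> t + 200 * d + 30 \<Longrightarrow> Q s' t'"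
  shows "wp apply_step Q s t"
proof -
  let ?G = "greedy_step P r T X"
  define keep where "keep l s' \<longleftrightarrow> inputs s' \<and> ix s' ''p'' 0 = p \<and> ix s' ''d'' 0 = d \<and> re s' ''T'' 0 = T \<and>
    ix s' ''l'' 0 = l \<and> re s' ''x'' = (\<lambda>j. if j \<in> col ` {..<l} then ?G j else X j) \<and>
    re s' ''sol'' = (\<lambda>j. if j \<in> col ` {..<l} then cap_floor P ?G j else re s ''sol'' j)"
    for l :: nat and s' :: state
  let ?I = "\<lambda>n s' t'. \<exists>l\<le>d. n = d - l \<and> keep l s' \<and> t' \<le> t + 200 * l + 10"
  have loop: "wp (While in_segment (Seq raise_entry (Seq round_entry next_entry))) Q s0 t0"
    if "keep 0 s0" "t0 \<le> t + 10" for s0 t0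
  proof (rule wp_While[where I = ?I and n = d])
    fix n s1 t1
    assume "?I n s1 t1" and g: "bval in_segment s1"
    then obtain l where I: "n = d - l" "keep l s1" "t1 \<le> t + 200 * l + 10"
      by blast
    have ld: "l < d"
      using g I by (simp add: in_segment_def keep_def)
    \<comment> \<open>The columns of a row are distinct, so the value read for entry
      \<open>l\<close> is still the original one.\<close>
    have new: "col l \<notin> col ` {..<l}"
    proof
      assume "col l \<in> col ` {..<l}"
      then obtain k where "k < l" "col l = col k"
        by auto
      with col_inj[of l k] ld show False
        by simp
    qed
    have img: "col ` {..<Suc l} = insert (col l) (col ` {..<l})"
      by (simp add: lessThan_Suc)
    show "wp (Seq raise_entry (Seq round_entry next_entry)) (\<lambda>s' t'. \<exists>n'<n. ?I n' s' t')
      s1 (t1 + (1 + btime in_segment))"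
      unfolding wp_Seq
    proof (rule wp_raise_entry[where l = l and T = T], goal_cases)
      case (7 s2 t2)
      have inp2: "inputs s2"
        by (rule inputs_cong[of s1]) (use I(2) 7 in \<open>simp_all add: keep_def\<close>)
      show ?case
      proof (rule wp_round_entry[where l = l], goal_cases)
        case (5 s3 t3)
        have inp3: "inputs (ix_write ''l'' 0 (Suc l) s3)"
          by (rule inputs_cong[OF inp2]) (use 5 in \<open>simp_all add: keep_def\<close>)
        have x: "re s3 ''x'' = (\<lambda>j. if j \<in> col ` {..<Suc l} then ?G j else X j)"
          using I(2) 7 5 unfolding img keep_def by (auto simp: fun_eq_iff)
        have "re s2 ''x'' (col l) = ?G (col l)"
          using 7 by simp
        then have "cap_floor P (re s2 ''x'') (col l) = cap_floor P ?G (col l)"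
          by (simp add: cap_floor_def)
        moreover have "re s2 ''sol'' = re s1 ''sol''"
          using 7(3) by simp
        ultimately have "re s3 ''sol'' = (re s1 ''sol'')(col l := cap_floor P ?G (col l))"
          using 5(1) by simp
        moreover have "re s1 ''sol'' = (\<lambda>j. if j \<in> col ` {..<l} then cap_floor P ?G j else re s ''sol'' j)"
          using I(2) by (simp add: keep_def)
        ultimately have sol: "re s3 ''sol'' = (\<lambda>j. if j \<in> col ` {..<Suc l} then cap_floor P ?G j else re s ''sol'' j)"
          unfolding img by (simp add: fun_eq_iff)
        have "keep (Suc l) (ix_write ''l'' 0 (Suc l) s3)"
          using inp3 x sol I(2) 7 5 unfolding keep_def by simp
        then have "?I (d - Suc l) (ix_write ''l'' 0 (Suc l) s3) (t3 + 6)"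
          using I(3) ld 7(4) 5(4) by (intro exI[of _ "Suc l"]) (simp add: in_segment_def)
        moreover have "d - Suc l < n"
          using I(1) ld by simp
        moreover have "ix s3 ''l'' 0 = l"
          using I(2) 7 5 by (simp add: keep_def)
        ultimately show ?case
          unfolding next_entry_def wp_ISet by (intro exI[of _ "d - Suc l"]) simp
      qed (use I(2) 7 ld inp2 in \<open>simp_all add: keep_def\<close>)
    qed (use I(2) ld new in \<open>simp_all add: keep_def\<close>)
  next
    fix n s1 t1
    assume "?I n s1 t1" and g: "\<not> bval in_segment s1"
    then obtain l where I: "l \<le> d" "keep l s1" "t1 \<le> t + 200 * l + 10"
      by blast
    then have l: "l = d"
      using g by (simp add: in_segment_def keep_def)
    have "re s1 ''x'' = ?G"
      using I(2) unfolding l keep_def col_image by (auto simp: greedy_step_def)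
    then show "Q s1 (t1 + (1 + btime in_segment))"
      using I unfolding l by (intro Q) (simp_all add: keep_def in_segment_def col_image)
  next
    show "?I d s0 t0"
      using that by (intro exI[of _ 0]) simp
  qed
  show ?thesis
    unfolding apply_step_def using inp st
    by (simp, intro loop) (simp_all add: keep_def inputs_cong[OF inp])
qed

text \<open>At time \<open>0\<close> all integer variables are in \<open>R\<close>, so
  \<open>slack_inv\<close> holds vacuously and no initial estimate of the slack is needed. Both
  counts in \<open>potential\<close> are at most \<open>d\<close>.\<close>

lemma progress_init:
  assumes filled: "filled s d"
    and st: "ix s ''d'' 0 = d" "re s ''big'' 0 = huge" "ix s ''run'' 0 = 1" "re s ''T'' 0 = 0"
      "re s ''b'' 0 = rhs P r"
    and trees: "tree_ok d (re s ''E'') (ix s ''E'')" "tree_ok d (re s ''M'') (ix s ''M'')"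
  shows "\<exists>m\<le>2 * d + 1. progress m s"
proof -
  have slot: "slot s l" if "l < d" for l
    using filled that by (simp add: filled_def)
  have stat: "static s"
    using st slot by (simp add: static_def slot_def)
  have tr: "trees_ok s ivars"
    using trees slot by (simp add: trees_ok_def slot_def)
  have al: "re s ''al'' 0 = offset (ix s ''mode'') cap"
    using filled slot unfolding filled_def offset_def by (auto intro!: sum.cong simp: slot_def)
  have rh: "re s ''rh'' 0 = rate (ix s ''mode'')"
    using filled slot unfolding filled_def rate_def by (auto intro!: sum.cong simp: slot_def)
  have key: "key s l = (if 0 < cst l \<and> cur l < cap l then cst l * (cap l - cur l) else huge)" 
    and mode: "ix s ''mode'' l = (if 0 < cst l \<and> cur l < cap l then 0 else 1)" if "l < d" for l
    using slot[OF that] by (simp_all add: key_def slot_def)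
  have "inv (ix s ''mode'') (key s) cap ivars 0"
    unfolding inv_def
  proof (intro conjI allI impI ballI)
    fix l assume l: "l < d"
    show "0 \<le> key s l"
      using key[OF l] big_nonneg by simp
    show "0 < cst l" "cur l < cap l" "key s l = cst l * (cap l - cur l)"
      if "ix s ''mode'' l = 0"
      using that mode[OF l] key[OF l] by (auto split: if_splits)
    show "saturated (key s) cap 0 l \<or> pending (key s) cap ivars 0 l" if "ix s ''mode'' l \<noteq> 0"
      using that mode[OF l] key[OF l] data_nonneg(2)[OF l] by (auto simp: saturated_def split: if_splits)
  qed auto
  then have "live s ivars cap"
    using stat tr st al rh by (simp add: live_def)
  then have "progress (potential s ivars) s"
    unfolding progress_def slack_inv_def by auto
  moreover have "card {l. l < d \<and> ix s ''mode'' l = 0} \<le> card {..<d}" "card ivars \<le> card {..<d}"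
    by (intro card_mono; auto simp: ivars_def)+
  then have "potential s ivars \<le> 2 * d + 1"
    by (simp add: potential_def)
  ultimately show ?thesis
    by blast
qed

end

abbreviation kept_ix :: "vname set" where
  "kept_ix \<equiv> {''p'', ''d'', ''nnz'', ''row'', ''col'', ''int''}"

abbreviation kept_re :: "vname set" where
  "kept_re \<equiv> {''val'', ''price'', ''ub'', ''rhs''}"

lemma kept_fill: "kept_ix \<inter> iwrites fill = {}" "(kept_re \<union> {''x'', ''sol'', ''big''}) \<inter> rwrites fill = {}"
  by (simp_all add: fill_def fill_copy_def fill_event_def next_entry_def)

lemma kept_iterate:
  "kept_ix \<inter> iwrites iterate = {}" "(kept_re \<union> {''x'', ''sol''}) \<inter> rwrites iterate = {}"
  by (simp_all add: iterate_def move_def settle_def rekey_def)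

lemma kept_apply_step: "kept_ix \<inter> iwrites apply_step = {}" "kept_re \<inter> rwrites apply_step = {}"
  by (simp_all add: apply_step_def raise_entry_def round_entry_def next_entry_def)

lemma kept_repair: "kept_ix \<inter> iwrites repair = {}" "kept_re \<inter> rwrites repair = {}"
  using kept_fill kept_iterate kept_apply_step unfolding repair_def by (simp_all add: Int_Un_distrib)

section \<open>Repairing one violated row\<close>

context segment
begin

lemma wp_repair:
  assumes inp: "inputs s" and st: "ix s ''p'' 0 = p" "ix s ''d'' 0 = d" "re s ''x'' = X"
      "re s ''big'' 0 = huge"
    and lg: "2 * d \<le> 2 ^ lg"
    and Q: "\<And>s' t' T. 0 \<le> T \<Longrightarrow> greedy_step P r T X \<in> row_constraint P r \<Longrightarrow>
      (\<And>t. 0 \<le> t \<Longrightarrow> greedy_step P r t X \<in> row_constraint P r \<Longrightarrow> T \<le> t) \<Longrightarrow>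
      re s' ''x'' = greedy_step P r T X \<Longrightarrow>
      re s' ''sol'' = (\<lambda>j. if j \<in> vars P r then cap_floor P (greedy_step P r T X) j else re s ''sol'' j) \<Longrightarrow>
      \<forall>v\<in>kept_ix. ix s' v = ix s v \<Longrightarrow> \<forall>v\<in>kept_re. re s' v = re s v \<Longrightarrow>
      t' \<le> t + d * (540 * lg + 4000) \<Longrightarrow> Q s' t'"
  shows "wp repair Q s t"
proof -
  have "wp repair (\<lambda>s' t'. \<exists>T\<ge>0. greedy_step P r T X \<in> row_constraint P r \<and>
      (\<forall>t\<ge>0. greedy_step P r t X \<in> row_constraint P r \<longrightarrow> T \<le> t) \<and>
      re s' ''x'' = greedy_step P r T X \<and>
      re s' ''sol'' = (\<lambda>j. if j \<in> vars P r then cap_floor P (greedy_step P r T X) j else re s ''sol'' j) \<and>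
      t' \<le> t + d * (540 * lg + 4000)) s t" (is "wp _ ?Q _ _")
    unfolding repair_def wp_Seq
  proof (rule wp_frame[of fill "\<lambda>s' t'. filled s' d \<and> ix s' ''run'' 0 = 1 \<and> re s' ''T'' 0 = 0 \<and>
      re s' ''b'' 0 = rhs P r \<and> t' \<le> t + 400 * d + 100"])
    show "wp fill (\<lambda>s' t'. filled s' d \<and> ix s' ''run'' 0 = 1 \<and> re s' ''T'' 0 = 0 \<and>
      re s' ''b'' 0 = rhs P r \<and> t' \<le> t + 400 * d + 100) s t"
      by (rule wp_fill[OF inp st]) auto
  next
    fix s1 t1
    assume f: "filled s1 d \<and> ix s1 ''run'' 0 = 1 \<and> re s1 ''T'' 0 = 0 \<and>
        re s1 ''b'' 0 = rhs P r \<and> t1 \<le> t + 400 * d + 100"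
      and "\<forall>v. v \<notin> iwrites fill \<longrightarrow> ix s1 v = ix s v" "\<forall>v. v \<notin> rwrites fill \<longrightarrow> re s1 v = re s v"
    then have k1: "\<forall>v\<in>kept_ix. ix s1 v = ix s v" "\<forall>v\<in>kept_re \<union> {''x'', ''sol'', ''big''}. re s1 v = re s v"
      using kept_fill by blast+
    have leaves: "leaves_ok d (ix s1 ''E'')" "leaves_ok d (ix s1 ''M'')"
      using f by (simp_all add: leaves_ok_def filled_def slot_def)
    show "wp (build_tree ''E'') (\<lambda>s t. wp (build_tree ''M'') (\<lambda>s t. wp (While running iterate)
        (\<lambda>s t. wp apply_step ?Q s t) s t) s t) s1 t1"
    proof (rule wp_build_tree[where d = d], goal_cases)
      case (6 s2 t2)
      show ?case
      proof (rule wp_build_tree[where d = d], goal_cases)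
        case (6 s3 t3)
        note E = \<open>tree_ok d (re s2 ''E'') (ix s2 ''E'')\<close> and M = 6
        note s2 = \<open>\<forall>l<d. re s2 ''E'' (d + l) = re s1 ''E'' (d + l)\<close>
          \<open>\<forall>b. b \<noteq> ''E'' \<longrightarrow> re s2 b = re s1 b\<close>
          \<open>\<forall>b. b \<noteq> ''E'' \<longrightarrow> b \<noteq> ''i'' \<longrightarrow> ix s2 b = ix s1 b\<close> \<open>t2 \<le> t1 + 60 * d\<close>
        have leaf: "ix s3 ''E'' (d + l) = l" "ix s3 ''M'' (d + l) = l" if "l < d" for l
          using E M that by (auto simp: tree_ok_def leaves_ok_def)
        have "slot s3 l" if "l < d" for l
        proof -
          have "slot s1 l"
            using f that by (simp add: filled_def)
          then show ?thesis
            using s2 M leaf[OF that] that unfolding slot_def by simp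
        qed
        then have f3: "filled s3 d"
          using f s2 M unfolding filled_def by simp
        have "\<exists>m\<le>2 * d + 1. progress m s3"
          by (rule progress_init[OF f3]) (use f k1 s2 M E st in simp_all)
        then obtain m where m: "m \<le> 2 * d + 1" "progress m s3"
          by blast
        show ?case
        proof (rule wp_frame[of "While running iterate" "\<lambda>s' t'. solved s' \<and> t' \<le> t3 + m * (180 * lg + 710) + 10"])
          show "wp (While running iterate) (\<lambda>s' t'. solved s' \<and> t' \<le> t3 + m * (180 * lg + 710) + 10) s3 t3"
            by (rule wp_search[OF m(2) d1 lg]) auto
        next
          fix s4 t4
          assume sv: "solved s4 \<and> t4 \<le> t3 + m * (180 * lg + 710) + 10"
            and "\<forall>v. v \<notin> iwrites (While running iterate) \<longrightarrow> ix s4 v = ix s3 v"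
              "\<forall>v. v \<notin> rwrites (While running iterate) \<longrightarrow> re s4 v = re s3 v"
          then have "\<forall>v\<in>kept_ix. ix s4 v = ix s3 v" "\<forall>v\<in>kept_re \<union> {''x'', ''sol''}. re s4 v = re s3 v"
            using kept_iterate unfolding iwrites.simps rwrites.simps by blast+
          then have k4: "\<forall>v\<in>kept_ix. ix s4 v = ix s v" "\<forall>v\<in>kept_re \<union> {''x'', ''sol''}. re s4 v = re s v"
            using k1 s2 M by simp_all
          have sol4: "re s4 ''sol'' = re s ''sol''"
            using k4 by simp
          have inp4: "inputs s4"
            by (rule inputs_cong[OF inp]) (use k4 in simp_all)
          define T where "T = re s4 ''T'' 0"
          have T: "0 \<le> T" "rhs P r \<le> total T" "\<And>t. 0 \<le> t \<Longrightarrow> rhs P r \<le> total t \<Longrightarrow> T \<le> t"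
            using sv by (auto simp: solved_def T_def)
          \<comment> \<open>From \<open>m \<le> 2 * d + 1 \<le> 3 * d\<close> come
            \<open>540 * lg\<close> and \<open>2130\<close> per entry; loading, the two tree
            constructions and the final update add \<open>720\<close>. The constant rest is absorbed
            because \<open>1 \<le> d\<close>.\<close>
          have time: "t4 + 200 * d + 30 \<le> t + d * (540 * lg + 4000)"
          proof -
            have "m * (180 * lg + 710) \<le> (3 * d) * (180 * lg + 710)"
              using m d1 by (intro mult_le_mono1) simp
            then have "t4 + 200 * d + 30 \<le> t + d * (540 * lg) + d * 2850 + 140"
              using sv M s2 f by (simp add: algebra_simps)
            then show ?thesis
              using d1 by (simp add: algebra_simps)
          qed
          show "wp apply_step ?Q s4 t4"
          proof (rule wp_apply_step[OF inp4, where T = T], goal_cases)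
            case (5 s5 t5)
            have "greedy_step P r T X \<in> row_constraint P r"
              using T total_iff by simp
            moreover have "\<forall>t\<ge>0. greedy_step P r t X \<in> row_constraint P r \<longrightarrow> T \<le> t"
              using T total_iff by simp
            moreover have "t5 \<le> t + d * (540 * lg + 4000)"
              using 5 time by simp
            ultimately show ?case
              using 5 T(1) sol4 by (intro exI[of _ T]) (simp only: simp_thms)
          qed (use k4 st in \<open>simp_all add: T_def\<close>)
        qed
      qed (use leaves 6 k1 st d1 in simp_all)
    qed (use leaves k1 st d1 in simp_all)
  qed
  then show ?thesis
  proof (rule wp_frame, elim exE conjE)
    fix s' :: state and t' :: nat and T :: real
    assume h: "0 \<le> T" "greedy_step P r T X \<in> row_constraint P r"
      "\<forall>t\<ge>0. greedy_step P r t X \<in> row_constraint P r \<longrightarrow> T \<le> t"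
      "re s' ''x'' = greedy_step P r T X"
      "re s' ''sol'' = (\<lambda>j. if j \<in> vars P r then cap_floor P (greedy_step P r T X) j else re s ''sol'' j)"
      "t' \<le> t + d * (540 * lg + 4000)"
      and "\<forall>v. v \<notin> iwrites repair \<longrightarrow> ix s' v = ix s v" "\<forall>v. v \<notin> rwrites repair \<longrightarrow> re s' v = re s v"
    then have "\<forall>v\<in>kept_ix. ix s' v = ix s v" "\<forall>v\<in>kept_re. re s' v = re s v"
      using kept_repair by blast+
    then show "Q s' t'"
      using h(3) by (intro Q[OF h(1,2) _ h(4,5) _ _ h(6)]) blast+
  qed
qed

end

section \<open>The pass over all rows\<close>

context inst
begin

text \<open>\<open>sol\<close> is kept equal to the rounded \<open>x\<close>, so that one scan of a
  row decides whether it is violated. The last clause says that \<open>p\<close> never lies inside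
  the block of a row.\<close>

definition good :: "state \<Rightarrow> nat \<Rightarrow> bool" where
  "good s p \<longleftrightarrow> inputs s \<and> ix s ''p'' 0 = p \<and> p \<le> length es \<and> greedy_reaches P (re s ''x'') \<and>
     (\<forall>j<nvars P. re s ''sol'' j = cap_floor P (re s ''x'') j) \<and>
     (\<forall>k<p. re s ''x'' \<in> row_constraint P (fst (es ! k))) \<and>
     (\<forall>k k'. k < p \<longrightarrow> p \<le> k' \<longrightarrow> k' < length es \<longrightarrow> fst (es ! k) < fst (es ! k'))"

lemma wp_solve_row:
  assumes good: "good s p" and p: "p < length es"
    and lg: "\<And>i. i < nrows P \<Longrightarrow> 2 * card (vars P i) \<le> 2 ^ lg"
    and Q: "\<And>s' t' p'. good s' p' \<Longrightarrow> p < p' \<Longrightarrow> t' \<le> t + (p' - p) * (540 * lg + 4900) \<Longrightarrow> Q s' t'"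
  shows "wp solve_row Q s t"
proof -
  let ?X = "re s ''x''"
  from good have inp: "inputs s" and ps: "ix s ''p'' 0 = p" and reach: "greedy_reaches P ?X"
    and sol: "\<And>j. j < nvars P \<Longrightarrow> re s ''sol'' j = cap_floor P ?X j"
    and rows: "\<And>k. k < p \<Longrightarrow> ?X \<in> row_constraint P (fst (es ! k))"
    and before: "\<And>k k'. k < p \<Longrightarrow> p \<le> k' \<Longrightarrow> k' < length es \<Longrightarrow> fst (es ! k) < fst (es ! k')"
    by (auto simp: good_def)
  have X0: "0 \<le> ?X j" for j
    by (rule greedy_reaches_nonneg[OF wf reach])
  show ?thesis
    unfolding solve_row_def wp_Seq
  proof (rule wp_scan[OF inp ps p], goal_cases)
    case (2 s1 t1 d)
    interpret segment P es p d ?X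
      using 2 p X0 by unfold_locales auto
    have inp1: "inputs s1"
      by (rule inputs_cong[OF inp]) (use 2 in simp_all)
    have st1: "ix s1 ''p'' 0 = p" "ix s1 ''d'' 0 = d" "re s1 ''x'' = ?X" "re s1 ''sol'' = re s ''sol''"
      using 2 ps by simp_all
    have big1: "re s1 ''big'' 0 = huge"
      using 2 by (simp add: huge_def col_def)
    have "re s1 ''L'' 0 = (\<Sum>l<d. mat P r (col l) * cap_floor P ?X (col l))"
      unfolding 2(5) by (intro sum.cong) (auto simp: sol col_less r_def col_def[symmetric])
    also have "\<dots> = (\<Sum>j\<in>vars P r. mat P r j * cap_floor P ?X j)"
      by (simp add: sum_vars)
    finally have L: "re s1 ''L'' 0 < rhs P r \<longleftrightarrow> ?X \<notin> row_constraint P r"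
      unfolding row_constraint_iff[OF wf] using X0 by auto
    have card: "card (vars P r) = d"
      unfolding col_image[symmetric] by (subst card_image) (auto simp: inj_on_def col_inj)
    have lgd: "2 * d \<le> 2 ^ lg"
      using lg[OF r_less] card by simp
    \<comment> \<open>Shared by both outcomes of the test. Earlier rows stay satisfied because
      \<open>x\<close> only grows, and the next position is again a row boundary because the block
      is a whole row.\<close>
    have finish: "Q s3 t3"
      if inp3: "inputs s3" and p3: "ix s3 ''p'' 0 = p + d" and reach3: "greedy_reaches P (re s3 ''x'')"
        and sol3: "\<And>j. j < nvars P \<Longrightarrow> re s3 ''sol'' j = cap_floor P (re s3 ''x'') j"
        and row3: "re s3 ''x'' \<in> row_constraint P r" and mono: "\<And>j. ?X j \<le> re s3 ''x'' j"
        and time: "t3 \<le> t + d * (540 * lg + 4900)" for s3 t3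
    proof (rule Q[of s3 "p + d"])
      have "re s3 ''x'' \<in> row_constraint P (fst (es ! k))" if k: "k < p + d" for k
      proof (cases "k < p")
        case True
        then show ?thesis
          using row_constraint_mono[OF wf entry_bounds(1) rows mono] p by simp
      next
        case False
        then have "fst (es ! k) = r"
          using seg[of k] k pd by (simp add: r_def)
        then show ?thesis
          using row3 by simp
      qed
      moreover have "fst (es ! k) < fst (es ! k')" if "k < p + d" "p + d \<le> k'" "k' < length es" for k k'
      proof -
        have "fst (es ! k) \<le> fst (es ! p)"
          using that seg[of k] before[of k p] p by (cases "k < p") auto
        moreover have "fst (es ! p) \<le> fst (es ! k')" "fst (es ! k') \<noteq> fst (es ! p)"
          using that seg[of k'] rows_sorted[of p k'] by auto
        ultimately show ?thesis
          by simp
      qed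
      ultimately show "good s3 (p + d)"
        using inp3 p3 reach3 sol3 pd by (simp add: good_def)
    qed (use d1 time in auto)
    have guard: "rval (RGet ''rhs'' (IGet ''row'' (iscal ''p''))) s1 = rhs P r"
      using input_entries[OF inp1, of 0] d1 st1 by simp
    show ?case
    proof (cases "?X \<in> row_constraint P r")
      case True
      let ?s = "ix_write ''p'' 0 (p + d) s1"
      have inp3: "inputs ?s"
        by (rule inputs_cong[OF inp1]) simp_all
      have "Q ?s t3" if "t3 \<le> t1 + 50" for t3
        by (rule finish[OF inp3])
          (use st1 reach sol True that 2 d1 in \<open>simp_all add: algebra_simps\<close>)
      then show ?thesis
        using True L guard st1 by simp
    next
      case False
      have "wp repair (\<lambda>s t. wp (iput ''p'' (entry ''d'')) Q s t) s1 t2" if t2: "t2 \<le> t1 + 50" for t2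
      proof (rule wp_repair[OF inp1 st1(1-3) big1 lgd], goal_cases)
        case (1 s2 t3 T)
        let ?s = "ix_write ''p'' 0 (p + d) s2"
        let ?G = "greedy_step P r T ?X"
        have inp2: "inputs s2"
          by (rule inputs_cong[OF inp1]) (use 1 in simp_all)
        have inp3: "inputs ?s"
          by (rule inputs_cong[OF inp2]) simp_all
        \<comment> \<open>Minimality of \<open>T\<close> among the sufficient step sizes becomes the
          admissibility condition of the greedy step.\<close>
        have "ereal T \<le> (INF y\<in>{y \<in> row_constraint P r. \<forall>j<nvars P. ?X j \<le> y j}.
            ereal (cost P y - cost P ?X))"
          by (rule step_size_le_INF[OF wf r_less X0 1(3)])
        then have reachG: "greedy_reaches P ?G"
          using greedy_reaches.step[OF reach r_less False 1(1)] by blast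
        have solG: "re s2 ''sol'' j = cap_floor P ?G j" if "j < nvars P" for j
          using 1(5) st1(4) sol[OF that] by (simp add: cap_floor_def greedy_step_def)
        have "Q ?s t4" if "t4 \<le> t3 + 20" for t4
        proof (rule finish[OF inp3])
          show "t4 \<le> t + d * (540 * lg + 4900)"
            using that 1(8) t2 2(9) d1 by (simp add: algebra_simps)
        qed (use 1 reachG solG greedy_step_ge[OF wf 1(1)] in simp_all)
        then show ?case
          using 1(6) st1 by simp
      qed
      then show ?thesis
        using False L guard by simp
    qed
  qed (use before p in auto)
qed

lemma wp_greedy_prog:
  assumes lg: "\<And>i. i < nrows P \<Longrightarrow> 2 * card (vars P i) \<le> 2 ^ lg"
    and Q: "\<And>s' t'. good s' (length es) \<Longrightarrow> t' \<le> length es * (540 * lg + 4910) + 10 \<Longrightarrow> Q s' t'"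
  shows "wp greedy_prog Q (input_state P es) 0"
proof -
  let ?I = "\<lambda>n s t. \<exists>p. good s p \<and> n = length es - p \<and> t \<le> p * (540 * lg + 4910)"
  show ?thesis
    unfolding greedy_prog_def
  proof (rule wp_While[where I = ?I and n = "length es"])
    fix n s t
    assume "?I n s t" and g: "bval unprocessed s"
    then obtain p where I: "good s p" "n = length es - p" "t \<le> p * (540 * lg + 4910)"
      by blast
    have p: "p < length es"
      using I g by (simp add: unprocessed_def good_def inputs_def)
    show "wp solve_row (\<lambda>s t. \<exists>n'<n. ?I n' s t) s (t + (1 + btime unprocessed))"
    proof (rule wp_solve_row[OF I(1) p lg])
      fix s' t' p'
      assume h: "good s' p'" "p < p'"
        "t' \<le> t + (1 + btime unprocessed) + (p' - p) * (540 * lg + 4900)"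
      obtain q where q: "p' = p + q" "1 \<le> q"
        using h(2) by (metis Suc_leI less_imp_add_positive plus_1_eq_Suc le_add1 One_nat_def)
      have "t' \<le> p' * (540 * lg + 4910)"
        using h(3) I(3) q by (simp add: unprocessed_def algebra_simps)
      moreover have "length es - p' < n"
        using h(2) p I(2) by simp
      ultimately show "\<exists>n'<n. ?I n' s' t'"
        using h(1) by blast
    qed
  next
    fix n s t
    assume "?I n s t" and g: "\<not> bval unprocessed s"
    then obtain p where I: "good s p" "t \<le> p * (540 * lg + 4910)"
      by blast
    moreover have "p = length es"
      using I g by (simp add: unprocessed_def good_def inputs_def)
    ultimately show "Q s (t + (1 + btime unprocessed))"
      by (intro Q) (simp_all add: unprocessed_def)
  next
    have x: "re (input_state P es) ''x'' = (\<lambda>_. 0)"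
      by (simp add: input_state_def)
    have "cap_floor P (\<lambda>_. 0) j = 0" if "j < nvars P" for j
      using wf that by (simp add: cap_floor_def wf_cmip_def)
    moreover have "re (input_state P es) ''sol'' j = 0" "ix (input_state P es) ''p'' 0 = 0" for j
      by (simp_all add: input_state_def)
    ultimately have "good (input_state P es) 0"
      using inputs_init greedy_reaches.start[of P] x by (simp add: good_def)
    then show "?I (length es) (input_state P es) 0"
      by (intro exI[of _ 0]) simp
  qed
qed

text \<open>A row without non-zeroes has no entries and is never visited; it holds because
  feasibility forces its right-hand side to be at most \<open>0\<close>.\<close>

lemma good_final:
  assumes "good s (length es)"
  shows "greedy_final P (re s ''x'')"
proof -
  have reach: "greedy_reaches P (re s ''x'')"
    using assms by (simp add: good_def)
  have "re s ''x'' \<in> row_constraint P i" if i: "i < nrows P" for i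
  proof (cases "vars P i = {}")
    case True
    obtain z where z: "z \<in> cmip_feasible P"
      using feasible by blast
    then have "rhs P i \<le> 0"
      using feasible_row_constraint[OF wf z i] True unfolding row_constraint_iff[OF wf] by simp
    then show ?thesis
      unfolding row_constraint_iff[OF wf] using True greedy_reaches_nonneg[OF wf reach] by simp
  next
    case False
    then obtain j where "(i, j) \<in> set es"
      using sparse i unfolding sparse_rows_def by auto
    then obtain k where "k < length es" "es ! k = (i, j)"
      by (auto simp: in_set_conv_nth)
    moreover have "\<forall>k<length es. re s ''x'' \<in> row_constraint P (fst (es ! k))"
      using assms by (simp add: good_def)
    ultimately show ?thesis
      by force
  qed
  with reach show ?thesis
    by (simp add: greedy_final_def)
qed

lemma length_es: "length es = nnz P"
proof -
  have "distinct es"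
    using sparse by (simp add: sparse_rows_def)
  then have "length es = card (set es)"
    by (simp add: distinct_card)
  also have "set es = Sigma {..<nrows P} (vars P)"
    using sparse by (auto simp: sparse_rows_def)
  also have "card (Sigma {..<nrows P} (vars P)) = nnz P"
    by (simp add: nnz_def finite_vars)
  finally show ?thesis .
qed

end

section \<open>The running time in terms of non-zeroes\<close>

lemma max_row_nnz_le_nnz: "max_row_nnz P \<le> nnz P"
  unfolding max_row_nnz_def nnz_def by (auto intro!: member_le_sum)

text \<open>For \<open>2 \<le> \<Delta>\<close> the logarithm is at least \<open>1\<close> and
  absorbs all additive constants: \<open>lg\<close> is the rounded-up logarithm plus
  \<open>1\<close>, and the cost per entry is at most \<open>540 * log 2 \<Delta> + 5995\<close>,
  below \<open>7000 * log 2 \<Delta>\<close>. For smaller \<open>\<Delta>\<close>,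
  \<open>lg = 1\<close> suffices and the time is linear.\<close>

lemma log_time_bound:
  assumes "\<Delta> \<le> N"
  obtains lg where "2 * \<Delta> \<le> 2 ^ lg"
    "real (N * (540 * lg + 4910) + 10) \<le>
       7000 * (if 2 \<le> \<Delta> then real N * log 2 (real \<Delta>) else real N + 1)"
proof (cases "2 \<le> \<Delta>")
  case True
  define k where "k = nat \<lceil>log 2 (real \<Delta>)\<rceil>"
  have l1: "1 \<le> log 2 (real \<Delta>)"
    using True by (simp add: le_log_iff)
  have k: "log 2 (real \<Delta>) \<le> real k" "real k \<le> log 2 (real \<Delta>) + 1"
    using l1 unfolding k_def by linarith+
  have "real \<Delta> = 2 powr log 2 (real \<Delta>)"
    using True by simp
  also have "\<dots> \<le> 2 powr real k"
    using k by simp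
  also have "\<dots> = real (2 ^ k)"
    by (simp add: powr_realpow)
  finally have "\<Delta> \<le> 2 ^ k"
    unfolding of_nat_le_iff .
  have N: "2 \<le> real N"
    using True assms by simp
  have "real (N * (540 * Suc k + 4910) + 10) = real N * (540 * real k + 5450) + 10"
    by (simp add: algebra_simps)
  also have "\<dots> \<le> real N * (540 * real k + 5450) + real N * 5"
    using N by simp
  also have "\<dots> = real N * (540 * real k + 5455)"
    by (simp add: algebra_simps)
  also have "\<dots> \<le> real N * (7000 * log 2 (real \<Delta>))"
    using k l1 by (intro mult_left_mono) auto
  finally have "real (N * (540 * Suc k + 4910) + 10) \<le> 7000 * (real N * log 2 (real \<Delta>))"
    by (simp add: algebra_simps)
  then show ?thesis
    using that[of "Suc k"] True \<open>\<Delta> \<le> 2 ^ k\<close> by simp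
next
  case False
  then show ?thesis
    using that[of 1] by simp
qed

theorem theorem3:
  shows "\<exists>(prog :: com) (K :: real).
    \<forall>(P :: cmip) (es :: (nat \<times> nat) list).
      wf_cmip P \<and> cmip_feasible P \<noteq> {} \<and> sparse_rows P es \<longrightarrow>
      (\<exists>(t :: nat) (s :: state) (x :: nat \<Rightarrow> real).
         exec prog (input_state P es) t s \<and>
         greedy_final P x \<and>
         (\<forall>j<nvars P. re s ''x'' j = x j) \<and>
         (\<forall>j<nvars P. re s ''sol'' j = cap_floor P x j) \<and>
         approx_solution P (real (max_row_nnz P)) (re s ''sol'') \<and>
         real t \<le> K * (if 2 \<le> max_row_nnz P
                       then real (nnz P) * log 2 (real (max_row_nnz P))
                       else real (nnz P) + 1))"
proof (intro exI[of _ greedy_prog] exI[of _ "7000::real"] allI impI)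
  fix P es
  assume "wf_cmip P \<and> cmip_feasible P \<noteq> {} \<and> sparse_rows P es"
  then interpret inst P es
    by unfold_locales auto
  obtain lg where lg: "2 * max_row_nnz P \<le> 2 ^ lg"
    and time: "real (nnz P * (540 * lg + 4910) + 10) \<le>
       7000 * (if 2 \<le> max_row_nnz P then real (nnz P) * log 2 (real (max_row_nnz P)) else real (nnz P) + 1)"
    using log_time_bound[OF max_row_nnz_le_nnz] by blast
  have "wp greedy_prog (\<lambda>s t. good s (length es) \<and> t \<le> nnz P * (540 * lg + 4910) + 10) (input_state P es) 0"
  proof (rule wp_greedy_prog)
    fix i assume "i < nrows P"
    then show "2 * card (vars P i) \<le> 2 ^ lg"
      using card_vars_le[of i P] lg by linarith
  qed (simp add: length_es)
  then obtain t s where exec: "exec greedy_prog (input_state P es) t s" and good: "good s (length es)"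
    and t: "t \<le> nnz P * (540 * lg + 4910) + 10"
    by (auto simp: wp_def)
  have sol: "re s ''sol'' j = cap_floor P (re s ''x'') j" if "j < nvars P" for j
    using good that by (simp add: good_def)
  have "real t \<le> real (nnz P * (540 * lg + 4910) + 10)"
    using t by (rule of_nat_mono)
  then show "\<exists>t s x. exec greedy_prog (input_state P es) t s \<and>
         greedy_final P x \<and>
         (\<forall>j<nvars P. re s ''x'' j = x j) \<and>
         (\<forall>j<nvars P. re s ''sol'' j = cap_floor P x j) \<and>
         approx_solution P (real (max_row_nnz P)) (re s ''sol'') \<and>
         real t \<le> 7000 * (if 2 \<le> max_row_nnz P
                       then real (nnz P) * log 2 (real (max_row_nnz P))
                       else real (nnz P) + 1)"
    using exec good_final[OF good] sol greedy_final_approx[OF wf feasible good_final[OF good] sol] time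
    by (intro exI[of _ t] exI[of _ s] exI[of _ "re s ''x''"]) (intro conjI; simp)
qed

end
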